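(* Let $n \ge 3$ and $m \ge 1$ be integers, let $q > \frac{n+2}{n}$ be a real number and let $p = \frac{n}{2}(q-1)$. Let $A = (A_{ij})$ be a constant, symmetric, positive definite real $m\times m$ matrix. Let $f^1,\dots,f^m : \mathbb{R}^m \to \mathbb{R}$ be $C^1$ functions for which there is a constant $C$ such that, for every $i = 1,\dots,m$ and every $V\in\mathbb{R}^m$, $$|f^i(V)| \le C|V|^q, \qquad |\nabla f^i(V)| \le C |V|^{q-1}.$$ Let $K \subset \mathbb{R}^n$ be compact, and let $V = (V_1,\dots,V_m) : \mathbb{R}^n\setminus K \to \mathbb{R}^m$ be a (classical, $C^2$) solution of $$\sum_{j=1}^m A_{ij}\,\Delta V_j = f^i(V), \qquad i = 1,\dots,m, \quad \text{in } \mathbb{R}^n\setminus K,$$ with $V \in L^p(\mathbb{R}^n\setminus K)$. Then, as $|x|\to\infty$, $$|V(x)| = O(|x|^{-(n-2)}) \quad\text{and}\quad |\nabla V(x)| = O(|x|^{-(n-1)}).$$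
   Context: $\Delta$ is the Euclidean Laplacian on $\mathbb{R}^n$, applied to each component. No sign condition is imposed on $V_i$ or $f^i$, and no variational structure is assumed. $|\nabla V|^2 = \sum_{i,j} |\partial_{x_i} V_j|^2$. *)

theory Defs
  imports "HOL-Analysis.Analysis" "HOL-Library.Landau_Symbols"
begin

(* Only meaningful at points where g is differentiable: frechet_derivative is a choice operator. *)
definition partial_deriv :: "'n::finite \<Rightarrow> (real^'n \<Rightarrow> real) \<Rightarrow> real^'n \<Rightarrow> real" where
  "partial_deriv i g x = frechet_derivative g (at x) (axis i 1)"

definition grad :: "(real^'n::finite \<Rightarrow> real) \<Rightarrow> real^'n \<Rightarrow> real^'n" where
  "grad g x = (\<chi> i. partial_deriv i g x)"

definition laplacian :: "(real^'n::finite \<Rightarrow> real) \<Rightarrow> real^'n \<Rightarrow> real" where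
  "laplacian g x = (\<Sum>i\<in>UNIV. partial_deriv i (partial_deriv i g) x)"

definition grad_norm :: "(real^'n::finite \<Rightarrow> real^'m::finite) \<Rightarrow> real^'n \<Rightarrow> real" where
  "grad_norm V x =
     sqrt (\<Sum>i\<in>UNIV. \<Sum>j\<in>UNIV. \<bar>partial_deriv i (\<lambda>y. V y $ j) x\<bar>\<^sup>2)"

(* C1_on and C2_on are used for open sets S only, so the derivatives "at x" on S depend only on
   the values on S. *)
definition C1_on :: "(real^'n::finite) set \<Rightarrow> (real^'n \<Rightarrow> real) \<Rightarrow> bool" where
  "C1_on S g \<longleftrightarrow>
     (\<forall>x\<in>S. g differentiable (at x)) \<and> (\<forall>i. continuous_on S (partial_deriv i g))"

definition C2_on :: "(real^'n::finite) set \<Rightarrow> (real^'n \<Rightarrow> real) \<Rightarrow> bool" where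
  "C2_on S g \<longleftrightarrow> C1_on S g \<and> (\<forall>i. C1_on S (partial_deriv i g))"

definition positive_definite :: "real^'m^'m::finite \<Rightarrow> bool" where
  "positive_definite A \<longleftrightarrow> (\<forall>v. v \<noteq> 0 \<longrightarrow> v \<bullet> (A *v v) > 0)"

definition in_Lp :: "real \<Rightarrow> (real^'n::finite) set \<Rightarrow> (real^'n \<Rightarrow> real^'m::finite) \<Rightarrow> bool" where
  "in_Lp p S g \<longleftrightarrow> g \<in> borel_measurable (lebesgue_on S) \<and>
     integrable (lebesgue_on S) (\<lambda>x. norm (g x) powr p)"

end

theory Submission
  imports Defs
begin

text \<open>
  Since \<open>A\<close> is invertible, the system gives \<open>|\<Delta>V| \<le> B |V|\<^sup>q\<close> with some constant \<open>B\<close>.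
  Put \<open>\<beta> = 2/(q-1)\<close>. This inequality and the \<open>L\<^sup>p\<close> norm are
  invariant under \<open>V \<mapsto> \<lambda>\<^sup>\<beta> V(\<lambda>x)\<close>, because \<open>\<beta>p = n\<close>. Every step rests on the maximum
  principle in its simplest form: at a local minimum no second partial derivative is negative.

  \<^bold>\<open>Scale-invariant decay.\<close> Integrability forces \<open>|V| = o(|x|^(-\<beta>))\<close>. Maximise
  \<open>(R - |x - x\<^sub>0|)\<^sup>\<beta> |V(x)|\<close> over a ball of radius \<open>R\<close> about \<open>x\<^sub>0\<close>. If the maximum is at least \<open>c\<close>,
  then around the maximiser \<open>z\<close> there is a ball of radius \<open>r\<close> with \<open>r\<^sup>\<beta> |V(z)|\<close> comparable to \<open>c\<close>,
  on which \<open>|V|\<close> is controlled by \<open>|V(z)|\<close>, and hence so is \<open>r\<^sup>2|\<Delta>V|\<close>. The interior gradient estimate for the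
  Laplacian (lemma \<open>interior_gradient_estimate_cball\<close>) then keeps \<open>|V| \<ge> |V(z)|/2\<close> on a fixed
  fraction of that ball, so the integral of \<open>|V|\<^sup>p\<close> there exceeds a positive constant that depends on \<open>c\<close>
  but not on \<open>R\<close>, \<open>x\<^sub>0\<close> or \<open>r\<close> (lemma \<open>small_mass_imp_small\<close>). Far away there is not enough mass left for this.

  \<^bold>\<open>Almost optimal decay.\<close> Now \<open>|\<Delta>V| \<le> o(|x|^(-2)) |V|\<close>, a perturbation of the Laplace equation by a
  potential that is small compared with the Hardy potential. The function
  \<open>|x|^(-a) + \<eta>|x|^(-\<delta>)\<close> with \<open>a = n-2-\<delta>\<close> is a strict supersolution for every \<open>\<eta> > 0\<close>, and its slowly
  decaying term dominates \<open>V\<close> at infinity. Comparison (lemma \<open>comparison_principle_exterior\<close>) and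
  \<open>\<eta> \<rightarrow> 0\<close> give \<open>|V| = O(|x|^(-a))\<close>.

  \<^bold>\<open>Optimal decay.\<close> If \<open>\<beta> \<ge> n-2\<close>, the first step already gives the claim. Otherwise \<open>(q-1)(n-2) > 2\<close>,
  so that the second step makes the potential \<open>O(|x|^(-2-\<sigma>))\<close> for some \<open>\<sigma> > 0\<close>. Subtracting a multiple of
  \<open>|x|^(-(n-2)-\<sigma>)\<close> from the harmonic function \<open>|x|^(-(n-2))\<close> yields a supersolution again, and comparison
  gives \<open>|V| = O(|x|^(-(n-2)))\<close>. The interior gradient estimate on balls of radius \<open>|x|/2\<close> gains the
  missing power of \<open>|x|\<close> for the derivatives.
\<close>

section \<open>Second derivatives along the axes and the maximum principle\<close>

text \<open>
  The maximum principle sees a function only along coordinate lines. Naming the derivatives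
  \<open>G\<close> and \<open>H\<close> explicitly lets them be computed term by term for linear combinations, reflections and powers of
  the norm.
\<close>
definition has_second_partials ::
  "(real^'n::finite) set \<Rightarrow> (real^'n \<Rightarrow> real) \<Rightarrow> ('n \<Rightarrow> real^'n \<Rightarrow> real) \<Rightarrow> ('n \<Rightarrow> real^'n \<Rightarrow> real) \<Rightarrow> bool"
  where "has_second_partials S g G H \<longleftrightarrow>
    (\<forall>x\<in>S. \<forall>i. ((\<lambda>s. g (x + s *\<^sub>R axis i 1)) has_real_derivative G i x) (at 0) \<and>
               ((\<lambda>s. G i (x + s *\<^sub>R axis i 1)) has_real_derivative H i x) (at 0))"

lemma has_second_partialsD:
  assumes "has_second_partials S g G H" "x \<in> S"
  shows "((\<lambda>s. g (x + s *\<^sub>R axis i 1)) has_real_derivative G i x) (at 0)"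
    and "((\<lambda>s. G i (x + s *\<^sub>R axis i 1)) has_real_derivative H i x) (at 0)"
  using assms by (auto simp: has_second_partials_def)

lemma has_second_partials_subset:
  "has_second_partials S g G H \<Longrightarrow> T \<subseteq> S \<Longrightarrow> has_second_partials T g G H"
  by (auto simp: has_second_partials_def)

lemma has_second_partials_add:
  assumes "has_second_partials S g G H" "has_second_partials S g' G' H'"
  shows "has_second_partials S (\<lambda>x. g x + g' x) (\<lambda>i x. G i x + G' i x) (\<lambda>i x. H i x + H' i x)"
  using assms unfolding has_second_partials_def by (auto intro!: DERIV_add)

lemma has_second_partials_cmult:
  assumes "has_second_partials S g G H"
  shows "has_second_partials S (\<lambda>x. c * g x) (\<lambda>i x. c * G i x) (\<lambda>i x. c * H i x)"
  using assms unfolding has_second_partials_def by (auto intro!: DERIV_cmult)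

lemma has_second_partials_sum:
  assumes "\<And>j. j \<in> J \<Longrightarrow> has_second_partials S (g j) (G j) (H j)"
  shows "has_second_partials S (\<lambda>x. \<Sum>j\<in>J. g j x) (\<lambda>i x. \<Sum>j\<in>J. G j i x) (\<lambda>i x. \<Sum>j\<in>J. H j i x)"
  using assms unfolding has_second_partials_def by (auto intro!: DERIV_sum)

lemma DERIV_along_axis:
  assumes "\<And>y. y \<in> S \<Longrightarrow> ((\<lambda>s. g (y + s *\<^sub>R axis i 1)) has_real_derivative G y) (at 0)"
    and "x + s *\<^sub>R axis i 1 \<in> S"
  shows "((\<lambda>s. g (x + s *\<^sub>R axis i 1)) has_real_derivative G (x + s *\<^sub>R axis i 1)) (at s)"
proof -
  have "((\<lambda>t. g ((x + s *\<^sub>R axis i 1) + t *\<^sub>R axis i 1)) has_real_derivative G (x + s *\<^sub>R axis i 1)) (at 0)"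
    using assms by blast
  then have "((\<lambda>t. g (x + (s + t) *\<^sub>R axis i 1)) has_real_derivative G (x + s *\<^sub>R axis i 1)) (at 0)"
    by (simp add: scaleR_add_left add.assoc)
  then show ?thesis
    using DERIV_shift[of "\<lambda>t. g (x + t *\<^sub>R axis i 1)" "G (x + s *\<^sub>R axis i 1)" 0 s]
    by (simp add: add.commute)
qed

text \<open>The maximum principle in the only form in which it is used below. A negative second derivative at
  a critical point would make the function decrease strictly to one side of it.\<close>
lemma second_partial_nonneg_at_min:
  assumes g: "has_second_partials S g G H" and "open S" "x \<in> S"
    and min: "\<And>y. y \<in> S \<Longrightarrow> g x \<le> g y"
  shows "0 \<le> H i x"
proof (rule ccontr)
  assume neg: "\<not> 0 \<le> H i x"
  let ?e = "axis i (1::real) :: real^'a"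
  obtain \<epsilon> where "\<epsilon> > 0" and ball: "ball x \<epsilon> \<subseteq> S"
    using \<open>open S\<close> \<open>x \<in> S\<close> openE by blast
  have inS: "x + s *\<^sub>R ?e \<in> S" if "\<bar>s\<bar> < \<epsilon>" for s
    using that ball by (auto simp: subset_eq dist_norm norm_axis_1)
  have d1: "((\<lambda>s. g (x + s *\<^sub>R ?e)) has_real_derivative G i (x + s *\<^sub>R ?e)) (at s)" if "\<bar>s\<bar> < \<epsilon>" for s
    using DERIV_along_axis[of S g i "G i" x s] has_second_partialsD(1)[OF g] inS[OF that] by auto
  have G0: "G i x = 0"
    by (rule DERIV_local_min[OF has_second_partialsD(1)[OF g \<open>x \<in> S\<close>] \<open>\<epsilon> > 0\<close>])
      (use min inS in auto)
  obtain \<delta> where "\<delta> > 0" and dec: "\<And>h. 0 < h \<Longrightarrow> h < \<delta> \<Longrightarrow> G i (x + h *\<^sub>R ?e) < 0"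
    using DERIV_neg_dec_right[OF has_second_partialsD(2)[OF g \<open>x \<in> S\<close>, of i]] neg G0 by auto
  define h where "h = min \<delta> \<epsilon> / 2"
  have h: "0 < h" "h < \<delta>" "h < \<epsilon>" using \<open>\<delta> > 0\<close> \<open>\<epsilon> > 0\<close> by (auto simp: h_def)
  obtain z where z: "0 < z" "z < h" and eq: "g (x + h *\<^sub>R ?e) - g (x + 0 *\<^sub>R ?e) = (h - 0) * G i (x + z *\<^sub>R ?e)"
    using MVT2[of 0 h "\<lambda>s. g (x + s *\<^sub>R ?e)" "\<lambda>s. G i (x + s *\<^sub>R ?e)"] d1 h by force
  have "(h - 0) * G i (x + z *\<^sub>R ?e) < 0"
    using dec[of z] z h by (simp add: mult_pos_neg)
  moreover have "g x \<le> g (x + h *\<^sub>R ?e)" using min inS h by simp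
  ultimately show False using eq by simp
qed

lemma DERIV_axis_partial_deriv:
  assumes "g differentiable (at x)"
  shows "((\<lambda>s. g (x + s *\<^sub>R axis i 1)) has_real_derivative partial_deriv i g x) (at 0)"
proof -
  have D: "(g has_derivative frechet_derivative g (at x)) (at x)"
    using assms frechet_derivative_works by blast
  have "((\<lambda>s::real. x + s *\<^sub>R axis i (1::real)) has_derivative (\<lambda>s. s *\<^sub>R axis i 1)) (at 0)"
    by (auto intro!: derivative_eq_intros)
  then have "((\<lambda>s. g (x + s *\<^sub>R axis i 1)) has_derivative (\<lambda>s. frechet_derivative g (at x) (s *\<^sub>R axis i 1))) (at 0)"
    using has_derivative_compose[where g = g] D by force
  moreover have "frechet_derivative g (at x) (s *\<^sub>R axis i 1) = partial_deriv i g x * s" for s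
    using linear_scale[OF has_derivative_linear[OF D]] by (simp add: partial_deriv_def)
  ultimately show ?thesis by (simp add: has_field_derivative_def)
qed

lemma C2_on_has_second_partials:
  assumes "C2_on S g"
  shows "has_second_partials S g (\<lambda>i. partial_deriv i g) (\<lambda>i. partial_deriv i (partial_deriv i g))"
  using assms unfolding C2_on_def C1_on_def has_second_partials_def
  by (auto intro!: DERIV_axis_partial_deriv)

lemma has_second_partials_separable:
  assumes "\<And>j t. (w j has_real_derivative w' j t) (at t)"
    and "\<And>j t. (w' j has_real_derivative w'' j t) (at t)"
  shows "has_second_partials S (\<lambda>y::real^'n::finite. \<Sum>j\<in>UNIV. w j (y $ j))
    (\<lambda>i y. w' i (y $ i)) (\<lambda>i y. w'' i (y $ i))"
  unfolding has_second_partials_def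
proof (intro ballI allI conjI)
  fix x :: "real^'n" and i
  have "((\<lambda>s. w j ((x + s *\<^sub>R axis i 1) $ j)) has_real_derivative (if j = i then w' i (x $ i) else 0)) (at 0)" for j
    using assms(1)[of i "0 + x $ i"] unfolding DERIV_shift by (auto simp: axis_def add.commute)
  then have "((\<lambda>s. \<Sum>j\<in>UNIV. w j ((x + s *\<^sub>R axis i 1) $ j)) has_real_derivative
      (\<Sum>j\<in>UNIV. if j = i then w' i (x $ i) else 0)) (at 0)"
    by (intro DERIV_sum)
  then show "((\<lambda>s. \<Sum>j\<in>UNIV. w j ((x + s *\<^sub>R axis i 1) $ j)) has_real_derivative w' i (x $ i)) (at 0)"
    by simp
  show "((\<lambda>s. w' i ((x + s *\<^sub>R axis i 1) $ i)) has_real_derivative w'' i (x $ i)) (at 0)"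
    using assms(2)[of i "0 + x $ i"] unfolding DERIV_shift by (auto simp: axis_def add.commute)
qed

definition reflect_coord :: "'n::finite \<Rightarrow> real \<Rightarrow> real^'n \<Rightarrow> real^'n" where
  "reflect_coord k c y = y - (2 * (y $ k - c)) *\<^sub>R axis k 1"

lemma reflect_coord_nth [simp]:
  "reflect_coord k c y $ j = (if j = k then 2 * c - y $ k else y $ j)"
  by (auto simp: reflect_coord_def axis_def)

lemma has_second_partials_reflect:
  assumes "has_second_partials S u G H"
  shows "has_second_partials {y. reflect_coord k c y \<in> S} (\<lambda>y. u (reflect_coord k c y))
    (\<lambda>i y. (if i = k then - 1 else 1) * G i (reflect_coord k c y)) (\<lambda>i y. H i (reflect_coord k c y))"
  unfolding has_second_partials_def
proof (intro ballI allI conjI)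
  fix x :: "real^'a" and i
  assume x: "x \<in> {y. reflect_coord k c y \<in> S}"
  let ?\<sigma> = "if i = k then - 1 else (1::real)"
  let ?r = "reflect_coord k c"
  have eq: "?r (x + s *\<^sub>R axis i 1) = ?r x + (?\<sigma> * s) *\<^sub>R axis i 1" for s
    by (auto simp: vec_eq_iff axis_def)
  have chain: "((\<lambda>s. F (?r (x + s *\<^sub>R axis i 1))) has_real_derivative ?\<sigma> * D) (at 0)"
    if "((\<lambda>s. F (?r x + s *\<^sub>R axis i 1)) has_real_derivative D) (at 0)" for F :: "real^'a \<Rightarrow> real" and D
    unfolding eq
  proof -
    have "((*) ?\<sigma> has_real_derivative ?\<sigma>) (at 0)"
      using DERIV_cmult_Id by blast
    then show "((\<lambda>s. F (?r x + (?\<sigma> * s) *\<^sub>R axis i 1)) has_real_derivative ?\<sigma> * D) (at 0)"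
      using DERIV_chain2[of "\<lambda>s. F (?r x + s *\<^sub>R axis i 1)" D "(*) ?\<sigma>" 0 ?\<sigma> UNIV] that
      by (simp add: mult.commute)
  qed
  show "((\<lambda>s. u (?r (x + s *\<^sub>R axis i 1))) has_real_derivative ?\<sigma> * G i (?r x)) (at 0)"
    using chain[of u "G i (?r x)"] has_second_partialsD(1)[OF assms] x by blast
  show "((\<lambda>s. ?\<sigma> * G i (?r (x + s *\<^sub>R axis i 1))) has_real_derivative H i (?r x)) (at 0)"
    using DERIV_cmult[OF chain[of "G i" "H i (?r x)"], of ?\<sigma>] has_second_partialsD(2)[OF assms] x
    by (auto split: if_splits)
qed

text \<open>Along a line the squared norm is a quadratic polynomial, so the power of the norm is differentiated as a
  power of that polynomial.\<close>
lemma DERIV_norm_powr_along_axis: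
  fixes x :: "real^'n::finite"
  assumes "x \<noteq> 0"
  shows "((\<lambda>s. norm (x + s *\<^sub>R axis i 1) powr b) has_real_derivative b * x $ i * norm x powr (b - 2)) (at 0)"
proof -
  have sq: "(norm (x + s *\<^sub>R axis i 1))\<^sup>2 = (norm x)\<^sup>2 + 2 * s * x $ i + s\<^sup>2" for s
    unfolding power2_norm_eq_inner
    by (simp add: inner_add_left inner_add_right inner_axis inner_axis' power2_eq_square algebra_simps)
  have pw: "norm y powr c = ((norm y)\<^sup>2) powr (c/2)" for y :: "real^'n" and c
    by (cases "y = 0") (simp_all add: powr_powr flip: powr_numeral)
  have "((\<lambda>s. ((norm x)\<^sup>2 + 2 * s * x $ i + s\<^sup>2) powr (b/2)) has_real_derivative
      (b/2) * ((norm x)\<^sup>2) powr (b/2 - 1) * (2 * x $ i)) (at 0)"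
    using assms by (auto intro!: derivative_eq_intros)
  moreover have "((norm x)\<^sup>2) powr (b/2 - 1) = norm x powr (b - 2)"
    using pw[of x "b - 2"] by (simp add: diff_divide_distrib)
  ultimately show ?thesis
    unfolding pw[of _ b] sq by (simp add: mult_ac)
qed

definition partial_norm_powr :: "real \<Rightarrow> 'n::finite \<Rightarrow> real^'n \<Rightarrow> real" where
  "partial_norm_powr b i x = b * x $ i * norm x powr (b - 2)"

definition second_partial_norm_powr :: "real \<Rightarrow> 'n::finite \<Rightarrow> real^'n \<Rightarrow> real" where
  "second_partial_norm_powr b i x =
    b * norm x powr (b - 2) + b * (b - 2) * (x $ i)\<^sup>2 * norm x powr (b - 4)"

lemma has_second_partials_norm_powr:
  "has_second_partials (- {0 :: real^'n::finite}) (\<lambda>x. norm x powr b)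
    (partial_norm_powr b) (second_partial_norm_powr b)"
  unfolding has_second_partials_def partial_norm_powr_def second_partial_norm_powr_def
proof (intro ballI allI conjI)
  fix x :: "real^'n" and i
  assume "x \<in> - {0}"
  then have "x \<noteq> 0" by simp
  show "((\<lambda>s. norm (x + s *\<^sub>R axis i 1) powr b) has_real_derivative b * x $ i * norm x powr (b - 2)) (at 0)"
    by (rule DERIV_norm_powr_along_axis) fact
  have "((\<lambda>s. b * (x $ i + s)) has_real_derivative b) (at 0)"
    by (auto intro!: derivative_eq_intros)
  from DERIV_mult[OF this DERIV_norm_powr_along_axis[OF \<open>x \<noteq> 0\<close>, of i "b - 2"]]
  show "((\<lambda>s. b * (x + s *\<^sub>R axis i 1) $ i * norm (x + s *\<^sub>R axis i 1) powr (b - 2)) has_real_derivative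
    b * norm x powr (b - 2) + b * (b - 2) * (x $ i)\<^sup>2 * norm x powr (b - 4)) (at 0)"
    by (simp add: axis_def power2_eq_square mult_ac)
qed

text \<open>For \<open>n > 2\<close> the factor vanishes for \<open>b = 0\<close> and \<open>b = 2 - n\<close>, is negative strictly between them and positive outside. All
  supersolutions below are built from this sign pattern.\<close>
lemma laplacian_norm_powr:
  fixes x :: "real^'n::finite"
  assumes "x \<noteq> 0"
  shows "(\<Sum>i\<in>UNIV. second_partial_norm_powr b i x) = b * (b + real CARD('n) - 2) * norm x powr (b - 2)"
proof -
  have "(\<Sum>i\<in>UNIV. (x $ i)\<^sup>2) = (norm x)\<^sup>2"
    by (simp add: norm_vec_def L2_set_def sum_nonneg)
  moreover have "(norm x)\<^sup>2 * norm x powr (b - 4) = norm x powr (b - 2)"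
    using assms powr_add[of "norm x" 2 "b - 4"] by (simp add: powr_numeral)
  moreover have "(\<Sum>i\<in>UNIV. second_partial_norm_powr b i x)
    = real CARD('n) * (b * norm x powr (b - 2)) + b * (b - 2) * ((\<Sum>i\<in>UNIV. (x $ i)\<^sup>2) * norm x powr (b - 4))"
    by (simp add: second_partial_norm_powr_def sum.distrib sum_distrib_left sum_distrib_right mult.assoc)
  ultimately show ?thesis by (simp add: algebra_simps)
qed

section \<open>An interior gradient estimate for the Laplacian\<close>

text \<open>Half the difference between \<open>u\<close> and its mirror image in the hyperplane through \<open>x\<close> orthogonal to the
  \<open>k\<close>-th axis vanishes on that hyperplane, and its \<open>k\<close>-th derivative at \<open>x\<close> is that of \<open>u\<close>. On the upper half of
  the cube it lies below an explicit quadratic barrier that also vanishes at \<open>x\<close>; comparing slopes at \<open>x\<close>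
  gives the bound. Strictness in the bound on the Laplacian makes the maximum principle applicable directly.\<close>
lemma partial_deriv_upper_bound_strict:
  fixes x :: "real^'n::finite" and u :: "real^'n \<Rightarrow> real"
  assumes u: "has_second_partials S u G H" and d: "d > 0"
    and S: "{y. \<forall>j. \<bar>y $ j - x $ j\<bar> \<le> d} \<subseteq> S" and cont: "continuous_on S u"
    and M: "\<And>y. \<forall>j. \<bar>y $ j - x $ j\<bar> \<le> d \<Longrightarrow> \<bar>u y\<bar> \<le> M"
    and N: "\<And>y. \<forall>j. \<bar>y $ j - x $ j\<bar> \<le> d \<Longrightarrow> \<bar>\<Sum>i\<in>UNIV. H i y\<bar> < N"
  shows "G k x \<le> real CARD('n) / d * M + d / 2 * N"
proof -
  let ?e = "axis k (1::real) :: real^'n"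
  let ?r = "reflect_coord k (x $ k)"
  let ?n = "real CARD('n)"
  define Cube where "Cube = {y::real^'n. \<forall>j. \<bar>y $ j - x $ j\<bar> \<le> d}"
  define Q where "Q = cbox (\<chi> j. if j = k then x $ k else x $ j - d) (\<chi> j. x $ j + d)"
  define U where "U = box (\<chi> j. if j = k then x $ k else x $ j - d) (\<chi> j. x $ j + d)"
  have memQ: "y \<in> Q \<longleftrightarrow> (\<forall>j. \<bar>y $ j - x $ j\<bar> \<le> d) \<and> x $ k \<le> y $ k" for y
  proof -
    have "y \<in> Q \<longleftrightarrow> (\<forall>j. (if j = k then x $ k else x $ j - d) \<le> y $ j \<and> y $ j \<le> x $ j + d)"
      by (simp add: Q_def mem_box_cart)
    also have "\<dots> \<longleftrightarrow> (\<forall>j. \<bar>y $ j - x $ j\<bar> \<le> d \<and> (j = k \<longrightarrow> x $ k \<le> y $ k))"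
      using d by (intro iff_allI) (auto simp: abs_le_iff)
    finally show ?thesis by blast
  qed
  have memU: "y \<in> U \<longleftrightarrow> (\<forall>j. \<bar>y $ j - x $ j\<bar> < d) \<and> x $ k < y $ k" for y
  proof -
    have "y \<in> U \<longleftrightarrow> (\<forall>j. (if j = k then x $ k else x $ j - d) < y $ j \<and> y $ j < x $ j + d)"
      by (simp add: U_def mem_box_cart)
    also have "\<dots> \<longleftrightarrow> (\<forall>j. \<bar>y $ j - x $ j\<bar> < d \<and> (j = k \<longrightarrow> x $ k < y $ k))"
      using d by (intro iff_allI) (auto simp: abs_less_iff)
    finally show ?thesis by blast
  qed
  have QC: "Q \<subseteq> Cube" by (auto simp: memQ Cube_def)
  have CS: "Cube \<subseteq> S" using S by (simp add: Cube_def)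
  have UQ: "U \<subseteq> Q" by (auto simp: memQ memU less_imp_le)
  have rC: "?r y \<in> Cube" if "y \<in> Cube" for y
  proof -
    have "\<bar>?r y $ j - x $ j\<bar> = \<bar>y $ j - x $ j\<bar>" for j by (simp add: abs_minus_commute)
    then show ?thesis using that unfolding Cube_def mem_Collect_eq by presburger
  qed
  have M0: "M \<ge> 0" using M[of x] d by (auto intro: order_trans[OF abs_ge_zero])
  have N0: "N > 0" using N[of x] d by (auto intro: le_less_trans[OF abs_ge_zero])
  \<comment> \<open>The barrier is a sum of functions of one variable: \<open>a t\<^sup>2\<close> in the directions other than \<open>k\<close>, and in
      direction \<open>k\<close> a concave quadratic. The coefficient \<open>n - 1\<close> cancels the other directions, so the total Laplacian
      is \<open>-N\<close>, while \<open>a d\<^sup>2 = M\<close> makes the barrier at least \<open>M\<close> on the outer faces of the half-cube.\<close>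
  define a where "a = M / d\<^sup>2"
  have a0: "a \<ge> 0" and ad: "a * d\<^sup>2 = M" using d M0 by (auto simp: a_def)
  define w where "w j t = (if j = k
      then a * ((t - x $ k) * (?n * d - (?n - 1) * (t - x $ k))) + N / 2 * ((t - x $ k) * (d - (t - x $ k)))
      else a * (t - x $ j)\<^sup>2)" for j t
  define w' where "w' j t = (if j = k
      then a * (?n * d - 2 * (?n - 1) * (t - x $ k)) + N / 2 * (d - 2 * (t - x $ k))
      else 2 * a * (t - x $ j))" for j t
  define w'' where "w'' j t = (if j = k then - (2 * (?n - 1) * a) - N else 2 * a)" for j and t :: real
  have dw: "(w j has_real_derivative w' j t) (at t)" for j t
    unfolding w_def w'_def
    by (cases "j = k") (auto intro!: derivative_eq_intros simp: algebra_simps)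
  have dw': "(w' j has_real_derivative w'' j t) (at t)" for j t
    unfolding w'_def w''_def
    by (cases "j = k") (auto intro!: derivative_eq_intros simp: algebra_simps)
  have sumw'': "(\<Sum>i\<in>UNIV. w'' i (y $ i)) = - N" for y :: "real^'n"
  proof -
    have "(\<Sum>i\<in>UNIV. w'' i (y $ i)) = w'' k (y $ k) + (\<Sum>i\<in>UNIV - {k}. w'' i (y $ i))"
      by (subst sum.remove[of _ k]) auto
    also have "(\<Sum>i\<in>UNIV - {k}. w'' i (y $ i)) = (\<Sum>i\<in>UNIV - {k}. 2 * a)"
      by (intro sum.cong) (auto simp: w''_def)
    also have "\<dots> = (?n - 1) * (2 * a)"
      by (simp add: card_Diff_singleton of_nat_diff)
    finally show ?thesis by (simp add: w''_def)
  qed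
  define \<Phi> where "\<Phi> y = (\<Sum>j\<in>UNIV. w j (y $ j)) + ((-1/2) * u y + (1/2) * u (?r y))" for y
  have HP: "has_second_partials U \<Phi>
      (\<lambda>i y. w' i (y $ i) + ((-1/2) * G i y + (1/2) * ((if i = k then - 1 else 1) * G i (?r y))))
      (\<lambda>i y. w'' i (y $ i) + ((-1/2) * H i y + (1/2) * H i (?r y)))"
    unfolding \<Phi>_def
  proof (intro has_second_partials_add has_second_partials_cmult has_second_partials_separable dw dw')
    show "has_second_partials U u G H"
      using has_second_partials_subset[OF u] QC UQ CS by (meson order_trans)
    have "U \<subseteq> {y. ?r y \<in> S}" using rC UQ QC CS by blast
    then show "has_second_partials U (\<lambda>x. u (?r x)) (\<lambda>i x. (if i = k then - 1 else 1) * G i (?r x)) (\<lambda>i x. H i (?r x))"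
      by (rule has_second_partials_subset[OF has_second_partials_reflect[OF u]])
  qed
  have "continuous_on Q \<Phi>"
  proof -
    have "continuous_on Q (\<lambda>y. w j (y $ j))" for j
    proof (rule continuous_on_compose2[of UNIV "w j"])
      show "continuous_on UNIV (w j)" using dw by (intro DERIV_continuous_on[of _ _ "w' j"]) blast
    qed (intro continuous_intros, simp)
    moreover have "continuous_on Q u" using continuous_on_subset[OF cont] order_trans[OF QC CS] by blast
    moreover have "continuous_on Q (\<lambda>y. u (?r y))"
    proof (rule continuous_on_compose2[OF cont])
      show "continuous_on Q ?r" unfolding reflect_coord_def by (intro continuous_intros)
      show "?r ` Q \<subseteq> S" using rC QC CS by blast
    qed
    ultimately show ?thesis unfolding \<Phi>_def by (intro continuous_intros)
  qed
  moreover have "compact Q" "Q \<noteq> {}"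
  proof -
    show "compact Q" by (simp add: Q_def)
    have "x \<in> Q" using d by (simp add: memQ)
    then show "Q \<noteq> {}" by blast
  qed
  ultimately obtain z where z: "z \<in> Q" and zmin: "\<And>y. y \<in> Q \<Longrightarrow> \<Phi> z \<le> \<Phi> y"
    using continuous_attains_inf[of Q \<Phi>] by blast
  have w_nonneg: "0 \<le> w j (y $ j)" and w_face: "\<bar>y $ j - x $ j\<bar> = d \<Longrightarrow> M \<le> w j (y $ j)"
    if "y \<in> Q" for y j
  proof -
    define t where "t = y $ j - x $ j"
    have t: "\<bar>t\<bar> \<le> d" "j = k \<Longrightarrow> 0 \<le> t" using that unfolding memQ t_def by simp_all
    have n1: "?n \<ge> 1" by (simp add: Suc_leI)
    have *: "0 \<le> (?n - 1) * (d - t)" using t(1) n1 by (intro mult_nonneg_nonneg) auto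
    have nt: "?n * d - (?n - 1) * t \<ge> d" using * by (simp add: algebra_simps)
    have wt: "w j (y $ j) = (if j = k then a * (t * (?n * d - (?n - 1) * t)) + N / 2 * (t * (d - t)) else a * t\<^sup>2)"
      by (simp add: w_def t_def)
    show "0 \<le> w j (y $ j)"
    proof (cases "j = k")
      case True
      have "0 \<le> a * (t * (?n * d - (?n - 1) * t))"
        using a0 t(2)[OF True] nt d by (intro mult_nonneg_nonneg) auto
      moreover have "0 \<le> N / 2 * (t * (d - t))"
        using N0 t(1) t(2)[OF True] by (intro mult_nonneg_nonneg) auto
      ultimately show ?thesis using True unfolding wt by simp
    next
      case False
      then show ?thesis unfolding wt using a0 by simp
    qed
    assume "\<bar>y $ j - x $ j\<bar> = d"
    then have td: "\<bar>t\<bar> = d" by (simp add: t_def)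
    show "M \<le> w j (y $ j)"
    proof (cases "j = k")
      case True
      then have "t = d" using td t by auto
      then show ?thesis using True ad unfolding wt by (simp add: algebra_simps power2_eq_square)
    next
      case False
      have "t\<^sup>2 = d\<^sup>2" using td by (metis power2_abs)
      then show ?thesis using False ad unfolding wt by simp
    qed
  qed
  \<comment> \<open>At an interior minimum the Laplacian of \<open>\<Phi>\<close> would be negative, so the minimum is attained either on the mirror
      hyperplane, where the antisymmetric part vanishes, or on an outer face.\<close>
  have "\<Phi> z \<ge> 0"
  proof (cases "z \<in> U")
    case True
    have "0 \<le> (\<Sum>i\<in>UNIV. w'' i (z $ i) + ((-1/2) * H i z + (1/2) * H i (?r z)))"
      by (intro sum_nonneg second_partial_nonneg_at_min[OF HP _ True]) (use zmin UQ U_def in auto)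
    also have "\<dots> = - N + (- (\<Sum>i\<in>UNIV. H i z) / 2 + (\<Sum>i\<in>UNIV. H i (?r z)) / 2)"
      by (simp add: sum.distrib sumw'' sum_negf sum_subtractf sum_divide_distrib)
    finally have False
      using N[of z] N[of "?r z"] z QC rC unfolding Cube_def by (auto simp: abs_less_iff)
    then show ?thesis ..
  next
    case False
    show ?thesis
    proof (cases "z $ k = x $ k")
      case True
      then have "?r z = z" by (simp add: vec_eq_iff)
      then show ?thesis unfolding \<Phi>_def by (simp add: w_nonneg[OF z] sum_nonneg)
    next
      case False
      then obtain j where j: "\<bar>z $ j - x $ j\<bar> = d"
        using \<open>z \<notin> U\<close> z unfolding memQ memU by (metis order_le_imp_less_or_eq)
      have "M \<le> w j (z $ j)" using w_face[OF z j] .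
      also have "\<dots> \<le> (\<Sum>j\<in>UNIV. w j (z $ j))"
        by (rule member_le_sum) (auto simp: w_nonneg[OF z])
      finally have "M \<le> (\<Sum>j\<in>UNIV. w j (z $ j))" .
      moreover have "\<bar>u z\<bar> \<le> M" "\<bar>u (?r z)\<bar> \<le> M"
        using M z QC rC Cube_def by blast+
      ultimately show ?thesis unfolding \<Phi>_def by (simp add: abs_le_iff)
    qed
  qed
  then have pos: "\<Phi> y \<ge> 0" if "y \<in> Q" for y using zmin that by (meson order_trans)
  \<comment> \<open>Since \<open>\<Phi>\<close> vanishes at \<open>x\<close> and is nonnegative above it, its slope at \<open>x\<close> cannot be negative.\<close>
  have xS: "x \<in> S" using S d by auto
  have "((\<lambda>s. u (?r (x + s *\<^sub>R ?e))) has_real_derivative - G k x) (at 0)"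
  proof -
    have "?r x = x" by (simp add: vec_eq_iff)
    then show ?thesis
      using xS has_second_partialsD(1)[OF has_second_partials_reflect[OF u, of k "x $ k"], of x k] by simp
  qed
  moreover have "((\<lambda>s. u (x + s *\<^sub>R ?e)) has_real_derivative G k x) (at 0)"
    by (rule has_second_partialsD(1)[OF u xS])
  moreover have "((\<lambda>s. \<Sum>j\<in>UNIV. w j ((x + s *\<^sub>R ?e) $ j)) has_real_derivative w' k (x $ k)) (at 0)"
    using has_second_partialsD(1)[OF has_second_partials_separable[of w w' w'' UNIV, OF dw dw']] by blast
  ultimately have "((\<lambda>s. \<Phi> (x + s *\<^sub>R ?e)) has_real_derivative w' k (x $ k) + ((-1/2) * G k x + (1/2) * - G k x)) (at 0)"
    unfolding \<Phi>_def by (intro DERIV_add DERIV_cmult)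
  then have D: "((\<lambda>s. \<Phi> (x + s *\<^sub>R ?e)) has_real_derivative w' k (x $ k) - G k x) (at 0)" by simp
  have \<Phi>x: "\<Phi> x = 0"
  proof -
    have "?r x = x" by (simp add: vec_eq_iff)
    moreover have "w j (x $ j) = 0" for j by (simp add: w_def)
    ultimately show ?thesis by (simp add: \<Phi>_def)
  qed
  have "w' k (x $ k) - G k x \<ge> 0"
  proof (rule ccontr)
    assume "\<not> ?thesis"
    then obtain \<delta> where \<delta>: "\<delta> > 0" "\<And>h. 0 < h \<Longrightarrow> h < \<delta> \<Longrightarrow> \<Phi> (x + h *\<^sub>R ?e) < 0"
      using DERIV_neg_dec_right[OF D] \<Phi>x by auto
    define h where "h = min \<delta> d / 2"
    have h: "0 < h" "h < \<delta>" "h \<le> d" using \<delta>(1) d by (auto simp: h_def)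
    have "x + h *\<^sub>R ?e \<in> Q" using h d by (auto simp: memQ axis_def)
    then show False using pos \<delta>(2)[OF h(1,2)] by fastforce
  qed
  moreover have "w' k (x $ k) = ?n / d * M + d / 2 * N"
    using d by (simp add: w'_def a_def field_simps power2_eq_square)
  ultimately show ?thesis by simp
qed

theorem interior_gradient_estimate:
  fixes x :: "real^'n::finite" and u :: "real^'n \<Rightarrow> real"
  assumes u: "has_second_partials S u G H" and d: "d > 0"
    and S: "{y. \<forall>j. \<bar>y $ j - x $ j\<bar> \<le> d} \<subseteq> S" and cont: "continuous_on S u"
    and M: "\<And>y. \<forall>j. \<bar>y $ j - x $ j\<bar> \<le> d \<Longrightarrow> \<bar>u y\<bar> \<le> M"
    and N: "\<And>y. \<forall>j. \<bar>y $ j - x $ j\<bar> \<le> d \<Longrightarrow> \<bar>\<Sum>i\<in>UNIV. H i y\<bar> \<le> N"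
  shows "\<bar>G k x\<bar> \<le> real CARD('n) / d * M + d / 2 * N"
proof (rule field_le_epsilon)
  fix \<epsilon> :: real
  assume "\<epsilon> > 0"
  \<comment> \<open>The strict bound with \<open>N'\<close> in place of \<open>N\<close> costs exactly \<open>\<epsilon>\<close>.\<close>
  define N' where "N' = N + 2 * \<epsilon> / d"
  have NN: "N < N'" using d \<open>\<epsilon> > 0\<close> by (simp add: N'_def)
  have "G k x \<le> real CARD('n) / d * M + d / 2 * N'"
    using partial_deriv_upper_bound_strict[OF u d S cont M, of N'] N NN by (meson le_less_trans)
  moreover have "-1 * G k x \<le> real CARD('n) / d * M + d / 2 * N'"
  proof (rule partial_deriv_upper_bound_strict[OF has_second_partials_cmult[OF u, of "-1"] d S])
    show "continuous_on S (\<lambda>y. -1 * u y)" by (intro continuous_intros cont)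
    show "\<bar>-1 * u y\<bar> \<le> M" if "\<forall>j. \<bar>y $ j - x $ j\<bar> \<le> d" for y
      using M[OF that] by simp
    show "\<bar>\<Sum>i\<in>UNIV. -1 * H i y\<bar> < N'" if "\<forall>j. \<bar>y $ j - x $ j\<bar> \<le> d" for y
      using N[OF that] NN by (simp add: sum_negf)
  qed
  moreover have "d / 2 * N' = d / 2 * N + \<epsilon>" using d by (simp add: N'_def field_simps)
  ultimately show "\<bar>G k x\<bar> \<le> real CARD('n) / d * M + d / 2 * N + \<epsilon>"
    unfolding abs_le_iff by (intro conjI; linarith)
qed

text \<open>A cube of half side \<open>r/n\<close> fits into the ball because the Euclidean norm is at most the sum of
  the moduli of the coordinates.\<close>
theorem interior_gradient_estimate_cball:
  fixes x :: "real^'n::finite" and u :: "real^'n \<Rightarrow> real"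
  assumes u: "has_second_partials S u G H" and r: "r > 0"
    and S: "cball x r \<subseteq> S" and cont: "continuous_on S u"
    and M: "\<And>y. y \<in> cball x r \<Longrightarrow> \<bar>u y\<bar> \<le> M"
    and N: "\<And>y. y \<in> cball x r \<Longrightarrow> \<bar>\<Sum>i\<in>UNIV. H i y\<bar> \<le> N"
  shows "\<bar>G k x\<bar> \<le> (real CARD('n))\<^sup>2 / r * M + r / (2 * real CARD('n)) * N"
proof -
  let ?n = "real CARD('n)"
  have cube: "y \<in> cball x r" if "\<forall>j. \<bar>y $ j - x $ j\<bar> \<le> r / ?n" for y
  proof -
    have "norm (y - x) \<le> (\<Sum>j\<in>UNIV. \<bar>(y - x) $ j\<bar>)" by (rule norm_le_l1_cart)
    also have "\<dots> \<le> (\<Sum>j\<in>(UNIV::'n set). r / ?n)" using that by (intro sum_mono) simp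
    also have "\<dots> = r" by simp
    finally show ?thesis by (simp add: dist_norm norm_minus_commute)
  qed
  have "\<bar>G k x\<bar> \<le> ?n / (r / ?n) * M + (r / ?n) / 2 * N"
    by (rule interior_gradient_estimate[OF u _ _ cont]) (use r S cube M N in auto)
  then show ?thesis by (simp add: power2_eq_square mult_ac)
qed

section \<open>Scale-invariant decay from integrability\<close>

definition vector_laplacian :: "(real^'n::finite \<Rightarrow> real^'m::finite) \<Rightarrow> real^'n \<Rightarrow> real^'m" where
  "vector_laplacian V x = (\<chi> j. laplacian (\<lambda>y. V y $ j) x)"

lemma C2_on_imp_C1_on: "C2_on S g \<Longrightarrow> C1_on S g"
  by (simp add: C2_on_def)

lemma continuous_on_if_C1_components:
  assumes "\<And>j. C1_on S (\<lambda>x. V x $ j)"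
  shows "continuous_on S (V :: real^'n::finite \<Rightarrow> real^'m::finite)"
proof -
  have "continuous_on S (\<lambda>x. \<chi> j. V x $ j)"
    using assms unfolding C1_on_def
    by (intro continuous_on_vec_lambda)
      (auto intro!: continuous_at_imp_continuous_on differentiable_imp_continuous_within)
  then show ?thesis by (simp add: vec_lambda_beta)
qed

lemma lipschitz_if_partial_derivs_bounded:
  fixes V :: "real^'n::finite \<Rightarrow> real^'m::finite"
  assumes C1: "\<And>j. C1_on S (\<lambda>x. V x $ j)" and "convex D" "D \<subseteq> S"
    and L: "\<And>x i j. x \<in> D \<Longrightarrow> \<bar>partial_deriv i (\<lambda>y. V y $ j) x\<bar> \<le> L"
    and "x \<in> D" "y \<in> D"
  shows "norm (V x - V y) \<le> real CARD('m) * (real CARD('n) * L) * norm (x - y)"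
proof -
  have "norm (V x $ j - V y $ j) \<le> (real CARD('n) * L) * norm (x - y)" for j
  proof (rule differentiable_bound[OF \<open>convex D\<close>])
    fix z assume z: "z \<in> D"
    let ?g = "\<lambda>y. V y $ j"
    have D: "(?g has_derivative frechet_derivative ?g (at z)) (at z)"
      using C1[of j] z \<open>D \<subseteq> S\<close> frechet_derivative_works unfolding C1_on_def by blast
    then show "(?g has_derivative frechet_derivative ?g (at z)) (at z within D)"
      by (rule has_derivative_at_withinI)
    show "onorm (frechet_derivative ?g (at z)) \<le> real CARD('n) * L"
    proof (rule onorm_le)
      fix v :: "real^'n"
      have lin: "linear (frechet_derivative ?g (at z))"
        using D has_derivative_linear by blast
      have "frechet_derivative ?g (at z) v = frechet_derivative ?g (at z) (\<Sum>i\<in>UNIV. v $ i *\<^sub>R axis i 1)"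
        using basis_expansion[of v] by (simp add: scalar_mult_eq_scaleR)
      also have "\<dots> = (\<Sum>i\<in>UNIV. v $ i * partial_deriv i ?g z)"
        by (simp add: linear_sum[OF lin] linear_scale[OF lin] partial_deriv_def)
      finally have "norm (frechet_derivative ?g (at z) v) \<le> (\<Sum>i\<in>UNIV. \<bar>v $ i * partial_deriv i ?g z\<bar>)"
        by simp
      also have "\<dots> \<le> (\<Sum>i\<in>(UNIV::'n set). norm v * L)"
        unfolding abs_mult by (intro sum_mono mult_mono L z component_le_norm_cart) auto
      finally show "norm (frechet_derivative ?g (at z) v) \<le> real CARD('n) * L * norm v"
        by (simp add: mult_ac)
    qed
  qed (use assms in auto)
  then have "(\<Sum>j\<in>UNIV. \<bar>(V x - V y) $ j\<bar>) \<le> (\<Sum>j\<in>(UNIV::'m set). (real CARD('n) * L) * norm (x - y))"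
    by (intro sum_mono) auto
  then show ?thesis
    using norm_le_l1_cart[of "V x - V y"] by simp
qed

lemma set_integral_le_superset:
  fixes f :: "'a \<Rightarrow> real"
  assumes B: "set_integrable M B f" and A: "A \<in> sets M" "A \<subseteq> B" and "\<And>x. 0 \<le> f x"
  shows "(LINT x:A|M. f x) \<le> (LINT x:B|M. f x)"
  unfolding set_lebesgue_integral_def
proof (rule integral_mono)
  show "integrable M (\<lambda>x. indicator A x *\<^sub>R f x)"
    using set_integrable_subset[OF B A] unfolding set_integrable_def .
  show "integrable M (\<lambda>x. indicator B x *\<^sub>R f x)"
    using B unfolding set_integrable_def .
qed (use assms in \<open>auto simp: indicator_def\<close>)

text \<open>What remains of the system after \<open>A\<close> has been inverted: a differential inequality for the whole vector
  together with integrability of the scale-invariant power of its norm.\<close>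
locale critical_exterior_solution =
  fixes V :: "real^'n::finite \<Rightarrow> real^'m::finite" and K :: "(real^'n) set" and q B :: real
  assumes dim: "CARD('n) \<ge> 3" and q: "q > 1" and B: "B \<ge> 0" and K: "compact K"
    and C2: "\<And>j. C2_on (- K) (\<lambda>x. V x $ j)"
    and laplacian_bound: "\<And>x. x \<notin> K \<Longrightarrow> norm (vector_laplacian V x) \<le> B * norm (V x) powr q"
    and integrable: "integrable (lebesgue_on (- K)) (\<lambda>x. norm (V x) powr (real CARD('n) / 2 * (q - 1)))"
begin

definition p :: real where "p = real CARD('n) / 2 * (q - 1)"

text \<open>The exponent for which \<open>\<lambda>\<^sup>\<beta> V(\<lambda>x)\<close> satisfies the same differential inequality as \<open>V\<close>.\<close>
definition \<beta> :: real where "\<beta> = 2 / (q - 1)"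

lemma \<beta>_pos: "\<beta> > 0" and p_pos: "p > 0"
  and \<beta>_times_q: "\<beta> * (q - 1) = 2" and \<beta>_times_p: "\<beta> * p = real CARD('n)"
  using q by (auto simp: \<beta>_def p_def divide_simps)

lemma continuous_V: "continuous_on (- K) V"
  using C2 C2_on_imp_C1_on continuous_on_if_C1_components by blast

lemma second_partials_V:
  "has_second_partials (- K) (\<lambda>x. V x $ j) (\<lambda>i. partial_deriv i (\<lambda>x. V x $ j))
    (\<lambda>i. partial_deriv i (partial_deriv i (\<lambda>x. V x $ j)))"
  by (rule C2_on_has_second_partials[OF C2])

lemma sum_second_partials_V:
  "(\<Sum>i\<in>UNIV. partial_deriv i (partial_deriv i (\<lambda>x. V x $ j)) x) = vector_laplacian V x $ j"
  by (simp add: vector_laplacian_def laplacian_def)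

lemma gradient_bound:
  assumes r: "r > 0" "cball x r \<subseteq> - K"
    and M: "\<And>y. y \<in> cball x r \<Longrightarrow> norm (V y) \<le> M"
    and N: "\<And>y. y \<in> cball x r \<Longrightarrow> norm (vector_laplacian V y) \<le> N"
  shows "\<bar>partial_deriv i (\<lambda>y. V y $ j) x\<bar> \<le> (real CARD('n))\<^sup>2 / r * M + r / (2 * real CARD('n)) * N"
proof (rule interior_gradient_estimate_cball[OF second_partials_V r])
  show "continuous_on (- K) (\<lambda>x. V x $ j)" by (intro continuous_intros continuous_V)
  show "\<bar>V y $ j\<bar> \<le> M" if "y \<in> cball x r" for y
    using M[OF that] component_le_norm_cart order_trans by blast
  show "\<bar>\<Sum>i\<in>UNIV. partial_deriv i (partial_deriv i (\<lambda>x. V x $ j)) y\<bar> \<le> N" if "y \<in> cball x r" for y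
    unfolding sum_second_partials_V using N[OF that] component_le_norm_cart order_trans by blast
qed

lemma open_exterior: "open (- K)"
  using K by (simp add: compact_imp_closed open_Compl)

definition mass :: "real \<Rightarrow> real" where
  "mass T = (LINT x:{x. T \<le> norm x} - K|lebesgue. norm (V x) powr p)"

lemma far_measurable: "{x::real^'n. T \<le> norm x} - K \<in> sets lebesgue"
proof -
  have "closed {x::real^'n. T \<le> norm x}" by (intro closed_Collect_le continuous_intros)
  moreover have "closed K" using K by (rule compact_imp_closed)
  ultimately show ?thesis
    by (intro sets.Diff sets_completionI_sets) (simp_all add: borel_closed)
qed

lemma set_integrable_far: "set_integrable lebesgue ({x. T \<le> norm x} - K) (\<lambda>x. norm (V x) powr p)"
proof (rule set_integrable_subset[OF _ far_measurable])
  show "set_integrable lebesgue (- K) (\<lambda>x. norm (V x) powr p)"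
    using integrable open_exterior unfolding set_integrable_def p_def
    by (subst (asm) integrable_restrict_space) auto
qed auto

lemma mass_mono:
  assumes "S \<le> T" shows "mass T \<le> mass S"
  unfolding mass_def
  by (rule set_integral_le_superset[OF set_integrable_far far_measurable]) (use assms in auto)

lemma mass_tendsto_0: "(\<lambda>k. mass (real k)) \<longlonglongrightarrow> 0"
proof -
  let ?g = "\<lambda>T x. indicator ({x. T \<le> norm x} - K) x *\<^sub>R (norm (V x) powr p)"
  have "(\<lambda>k. LINT x|lebesgue. ?g (real k) x) \<longlonglongrightarrow> (LINT x|lebesgue. (\<lambda>x::real^'n. 0::real) x)"
  proof (rule integral_dominated_convergence[where w = "?g 0"])
    show "?g (real k) \<in> borel_measurable lebesgue" for k
      using set_integrable_far unfolding set_integrable_def by (rule borel_measurable_integrable)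
    show "integrable lebesgue (?g 0)"
      using set_integrable_far unfolding set_integrable_def .
    show "AE x in lebesgue. (\<lambda>k. ?g (real k) x) \<longlonglongrightarrow> 0"
    proof (rule AE_I2)
      fix x :: "real^'n"
      obtain m where m: "norm x < real m" using reals_Archimedean2 by blast
      have "\<forall>\<^sub>F k in sequentially. ?g (real k) x = 0"
        using eventually_ge_at_top[of m] by eventually_elim (use m in \<open>auto simp: indicator_def\<close>)
      then show "(\<lambda>k. ?g (real k) x) \<longlonglongrightarrow> 0" by (rule tendsto_eventually)
    qed
    show "AE x in lebesgue. norm (?g (real k) x) \<le> ?g 0 x" for k
      by (rule AE_I2) (auto simp: indicator_def)
  qed auto
  then show ?thesis by (simp add: mass_def set_lebesgue_integral_def)
qed

lemma mass_eventually_small: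
  assumes "\<epsilon> > 0" obtains T0 where "\<And>T. T0 \<le> T \<Longrightarrow> mass T < \<epsilon>"
proof -
  have "\<forall>\<^sub>F k in sequentially. mass (real k) < \<epsilon>"
    by (rule order_tendstoD(2)[OF mass_tendsto_0 assms])
  then obtain k where k: "mass (real k) < \<epsilon>"
    using eventually_happens'[OF sequentially_bot] by blast
  show thesis
  proof (rule that)
    show "mass T < \<epsilon>" if "real k \<le> T" for T
      using mass_mono[OF that] k by simp
  qed
qed

text \<open>The link between pointwise size and mass: this is the only way in which integrability is turned into
  pointwise information.\<close>
lemma mass_lower_bound:
  assumes r: "r > 0" and sub: "ball x r \<subseteq> {y. T \<le> norm y} - K" and a: "a \<ge> 0"
    and V: "\<And>y. y \<in> ball x r \<Longrightarrow> a \<le> norm (V y)"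
  shows "a powr p * (unit_ball_vol (real CARD('n)) * r ^ CARD('n)) \<le> mass T"
proof -
  have fin: "emeasure lebesgue (ball x r) < \<infinity>"
    using emeasure_bounded_finite[OF bounded_ball] by simp
  have "(LINT y:ball x r|lebesgue. a powr p) \<le> (LINT y:ball x r|lebesgue. norm (V y) powr p)"
  proof (rule set_integral_mono)
    show "set_integrable lebesgue (ball x r) (\<lambda>y. a powr p)"
      unfolding set_integrable_def using fin by (intro integrable_scaleR_left integrable_real_indicator) auto
    show "set_integrable lebesgue (ball x r) (\<lambda>y. norm (V y) powr p)"
      by (rule set_integrable_subset[OF set_integrable_far _ sub]) simp
  qed (use V a p_pos in \<open>auto intro!: powr_mono2\<close>)
  also have "\<dots> \<le> mass T"
    unfolding mass_def
    by (rule set_integral_le_superset[OF set_integrable_far _ sub]) auto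
  also have "(LINT y:ball x r|lebesgue. a powr p) = measure lebesgue (ball x r) * a powr p"
    by (simp add: set_lebesgue_integral_def)
  finally show ?thesis using content_ball[of r x] r by (simp add: mult.commute)
qed

text \<open>The weight vanishes on the boundary of the ball and is raised to the scale-invariant power \<open>\<beta>\<close>, so that
  its maximiser \<open>z\<close> carries its own length scale \<open>r\<close>: on the ball of radius \<open>r\<close> about \<open>z\<close> all estimates, in units of \<open>|V(z)|\<close> and \<open>r\<close>,
  depend only on \<open>c\<close>.
  In particular \<open>|V|\<close> stays comparable to \<open>|V(z)|\<close> on a ball of radius \<open>\<tau>r\<close>, whose mass is at least
  a multiple of \<open>|V(z)|\<^sup>p r\<^sup>n = (r\<^sup>\<beta> |V(z)|)\<^sup>p\<close>.\<close>
lemma small_mass_imp_small: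
  assumes c: "c > 0"
  obtains \<epsilon> where "\<epsilon> > 0"
    and "\<And>x R T. R > 0 \<Longrightarrow> cball x R \<subseteq> {y. T \<le> norm y} - K \<Longrightarrow> mass T < \<epsilon> \<Longrightarrow> R powr \<beta> * norm (V x) < c"
proof -
  let ?n = "real CARD('n)" and ?m = "real CARD('m)"
  \<comment> \<open>In units of \<open>|V(z)|/r\<close>, \<open>L\<close> is the gradient bound on the ball of radius \<open>r/2\<close>, and \<open>\<tau>\<close> is chosen so that \<open>V\<close>
      changes by at most half of \<open>|V(z)|\<close> over a distance \<open>\<tau>r\<close>.\<close>
  define L where "L = 2 * ?n\<^sup>2 * 2 powr \<beta> + B * (2 powr \<beta>) powr q * (c powr (q - 1) / 4) / (4 * ?n)"
  have L: "L > 0"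
    unfolding L_def using B by (intro add_pos_nonneg mult_pos_pos divide_nonneg_nonneg mult_nonneg_nonneg) auto
  define \<tau> where "\<tau> = min (1/2) (1 / (2 * (?m * (?n * L))))"
  have \<tau>: "\<tau> > 0" "\<tau> \<le> 1/2" "?m * (?n * L) * \<tau> \<le> 1/2"
  proof -
    have pos: "?m * (?n * L) > 0" using L by simp
    then show "\<tau> > 0" "\<tau> \<le> 1/2" by (auto simp: \<tau>_def)
    have "?m * (?n * L) * \<tau> \<le> ?m * (?n * L) * (1 / (2 * (?m * (?n * L))))"
      using pos by (intro mult_left_mono) (auto simp: \<tau>_def)
    also have "\<dots> = 1/2" using pos L by (simp add: field_simps)
    finally show "?m * (?n * L) * \<tau> \<le> 1/2" .
  qed
  define \<epsilon> where "\<epsilon> = unit_ball_vol ?n * \<tau> ^ CARD('n) * (1/2) powr p * (c powr p / 2 ^ CARD('n))"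
  have "\<epsilon> > 0" unfolding \<epsilon>_def using \<tau> c by (intro mult_pos_pos divide_pos_pos) auto
  moreover have "R powr \<beta> * norm (V x) < c"
    if R: "R > 0" and sub: "cball x R \<subseteq> {y. T \<le> norm y} - K" and mass: "mass T < \<epsilon>" for x R T
  proof (rule ccontr)
    assume not: "\<not> R powr \<beta> * norm (V x) < c"
    define h where "h y = (R - dist x y) powr \<beta> * norm (V y)" for y
    have "continuous_on (cball x R) h"
      unfolding h_def using \<beta>_pos sub
      by (intro continuous_intros continuous_on_powr' continuous_on_subset[OF continuous_V]) auto
    then obtain z where z: "z \<in> cball x R" and zmax: "\<And>y. y \<in> cball x R \<Longrightarrow> h y \<le> h z"
      using continuous_attains_sup[of "cball x R" h] R by auto
    have hz: "c \<le> h z" using not zmax[of x] R by (simp add: h_def)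
    define s where "s = R - dist x z"
    define M where "M = norm (V z)"
    have s: "s > 0" and M: "M > 0"
    proof -
      have "s \<ge> 0" using z by (simp add: s_def)
      moreover have "s \<noteq> 0" "M \<noteq> 0" using hz c \<beta>_pos by (auto simp: h_def s_def M_def)
      ultimately show "s > 0" "M > 0" by (auto simp: M_def)
    qed
    have hzs: "h z = s powr \<beta> * M" by (simp add: h_def s_def M_def)
    \<comment> \<open>Chosen so that \<open>(2r)\<^sup>\<beta> |V(z)| = c\<close>. As the maximum is at least \<open>c\<close>, the ball of radius \<open>2r\<close> about \<open>z\<close> stays inside.\<close>
    define r where "r = (c / M) powr (1 / \<beta>) / 2"
    have r: "r > 0" using c M by (simp add: r_def)
    have twor: "(2 * r) powr \<beta> = c / M" using c M \<beta>_pos by (simp add: r_def powr_powr)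
    have "2 * r \<le> s"
    proof -
      have "(2 * r) powr \<beta> \<le> s powr \<beta>" using hz M unfolding twor hzs by (simp add: field_simps)
      then show ?thesis using \<beta>_pos r s powr_less_mono2[of \<beta> s "2 * r"] by (meson linorder_not_less less_imp_le)
    qed
    then have rs: "r \<le> s / 2" by simp
    have ball_sub: "cball z r \<subseteq> cball x R"
    proof
      fix y assume "y \<in> cball z r"
      then show "y \<in> cball x R" using rs s dist_triangle[of x y z] by (simp add: s_def)
    qed
    have V_le: "norm (V y) \<le> 2 powr \<beta> * M" if y: "y \<in> cball z r" for y
    proof -
      have "s / 2 \<le> R - dist x y"
        using y rs dist_triangle[of x y z] by (simp add: s_def)
      then have "(s / 2) powr \<beta> * norm (V y) \<le> h y"
        unfolding h_def using s \<beta>_pos by (intro mult_right_mono powr_mono2) auto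
      also have "\<dots> \<le> s powr \<beta> * M" using zmax ball_sub y hzs by auto
      finally show ?thesis using s by (simp add: powr_divide field_simps)
    qed
    have Mq: "M powr q = M * (c powr (q - 1) / 4) / r\<^sup>2"
    proof -
      have "M = c / (2 * r) powr \<beta>" using twor M c by simp
      then have "M powr (q - 1) = c powr (q - 1) / ((2 * r) powr \<beta>) powr (q - 1)"
        using c r by (metis powr_divide powr_ge_zero less_imp_le)
      also have "((2 * r) powr \<beta>) powr (q - 1) = (2 * r)\<^sup>2"
        using r by (simp add: powr_powr \<beta>_times_q powr_numeral)
      finally have "M powr (q - 1) = c powr (q - 1) / (4 * r\<^sup>2)" by (simp add: power_mult_distrib)
      moreover have "M powr q = M * M powr (q - 1)" using M powr_add[of M 1 "q - 1"] by simp
      ultimately show ?thesis by simp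
    qed
    have grad: "\<bar>partial_deriv i (\<lambda>y. V y $ j) y\<bar> \<le> L * M / r" if y: "y \<in> cball z (r/2)" for y i j
    proof -
      have sub': "cball y (r/2) \<subseteq> cball z r"
      proof
        fix y' assume "y' \<in> cball y (r/2)"
        then show "y' \<in> cball z r" using y dist_triangle[of z y' y] by simp
      qed
      have "\<bar>partial_deriv i (\<lambda>y. V y $ j) y\<bar>
        \<le> ?n\<^sup>2 / (r/2) * (2 powr \<beta> * M) + (r/2) / (2 * ?n) * (B * (2 powr \<beta> * M) powr q)"
      proof (rule gradient_bound)
        show "r / 2 > 0" using r by simp
        show "cball y (r / 2) \<subseteq> - K" using sub' ball_sub sub by blast
        show "norm (V y') \<le> 2 powr \<beta> * M" if "y' \<in> cball y (r / 2)" for y'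
          using V_le sub' that by blast
        show "norm (vector_laplacian V y') \<le> B * (2 powr \<beta> * M) powr q" if y': "y' \<in> cball y (r / 2)" for y'
        proof -
          have "y' \<notin> K" using y' sub' ball_sub sub by blast
          then have "norm (vector_laplacian V y') \<le> B * norm (V y') powr q" by (rule laplacian_bound)
          also have "\<dots> \<le> B * (2 powr \<beta> * M) powr q"
            using B q V_le sub' y' by (intro mult_left_mono powr_mono2) auto
          finally show ?thesis .
        qed
      qed
      also have "(2 powr \<beta> * M) powr q = (2 powr \<beta>) powr q * (M * (c powr (q - 1) / 4) / r\<^sup>2)"
        using M by (simp add: powr_mult Mq)
      also have "?n\<^sup>2 / (r/2) * (2 powr \<beta> * M) + (r/2) / (2 * ?n) * (B * ((2 powr \<beta>) powr q * (M * (c powr (q - 1) / 4) / r\<^sup>2)))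
        = L * M / r"
        unfolding L_def using r by (simp add: field_simps power2_eq_square)
      finally show ?thesis .
    qed
    have V_ge: "M / 2 \<le> norm (V y)" if y: "y \<in> ball z (\<tau> * r)" for y
    proof -
      have \<tau>r: "\<tau> * r \<le> r / 2" using \<tau> r by simp
      have "norm (V z - V y) \<le> ?m * (?n * (L * M / r)) * norm (z - y)"
      proof (rule lipschitz_if_partial_derivs_bounded[where S = "- K" and D = "cball z (r/2)"])
        show "cball z (r / 2) \<subseteq> - K"
        proof -
          have "cball z (r/2) \<subseteq> cball z r" using r by (intro subset_cball) simp
          then show ?thesis using ball_sub sub by blast
        qed
        show "y \<in> cball z (r / 2)" using y \<tau>r by simp
        show "z \<in> cball z (r / 2)" using r by simp
      qed (use grad C2_on_imp_C1_on[OF C2] in auto)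
      also have "\<dots> \<le> ?m * (?n * (L * M / r)) * (\<tau> * r)"
        using y L M r by (intro mult_left_mono) (auto simp: dist_norm)
      also have "\<dots> = (?m * (?n * L) * \<tau>) * M" using r by (simp add: field_simps)
      also have "\<dots> \<le> 1/2 * M" using \<tau> M by (intro mult_right_mono) auto
      finally show ?thesis using norm_triangle_ineq2[of "V z" "V y"] by (simp add: M_def)
    qed
    have "(M / 2) powr p * (unit_ball_vol ?n * (\<tau> * r) ^ CARD('n)) \<le> mass T"
    proof (rule mass_lower_bound)
      show "\<tau> * r > 0" using \<tau> r by simp
      have "\<tau> * r \<le> r" using \<tau> r by simp
      then have "ball z (\<tau> * r) \<subseteq> cball z r" by auto
      then show "ball z (\<tau> * r) \<subseteq> {y. T \<le> norm y} - K" using ball_sub sub by blast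
    qed (use V_ge M in auto)
    also have "(M / 2) powr p * (unit_ball_vol ?n * (\<tau> * r) ^ CARD('n)) = \<epsilon>"
    proof -
      have "(2 * r) ^ CARD('n) = (c / M) powr p"
        using r \<beta>_times_p powr_realpow[of "2 * r" "CARD('n)"] by (simp flip: twor add: powr_powr)
      then have rn: "r ^ CARD('n) = c powr p / M powr p / 2 ^ CARD('n)"
        using c M by (simp add: power_mult_distrib powr_divide field_simps)
      have M2: "(M / 2) powr p = M powr p * (1/2) powr p" using M powr_mult[of M "1/2" p] by simp
      show ?thesis unfolding \<epsilon>_def M2 power_mult_distrib rn using M by (simp add: field_simps)
    qed
    finally show False using mass by simp
  qed
  ultimately show thesis by (rule that)
qed

text \<open>Lemma \<open>small_mass_imp_small\<close> is applied to the balls about \<open>x\<close> of radius \<open>|x|/2\<close>: they escape to infinity, so their mass becomes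
  arbitrarily small.\<close>
lemma V_little_o:
  assumes "c > 0"
  shows "\<forall>\<^sub>F x in at_infinity. norm (V x) \<le> c * norm x powr - \<beta>"
proof -
  obtain \<epsilon> where \<epsilon>: "\<epsilon> > 0"
    and small: "\<And>x R T. R > 0 \<Longrightarrow> cball x R \<subseteq> {y. T \<le> norm y} - K \<Longrightarrow> mass T < \<epsilon> \<Longrightarrow>
      R powr \<beta> * norm (V x) < c / 2 powr \<beta>"
    using small_mass_imp_small[of "c / 2 powr \<beta>"] assms by auto
  obtain T0 where T0: "\<And>T. T0 \<le> T \<Longrightarrow> mass T < \<epsilon>" using mass_eventually_small[OF \<epsilon>] by blast
  obtain b where b: "b > 0" "\<And>y. y \<in> K \<Longrightarrow> norm y \<le> b"
    using compact_imp_bounded[OF K] bounded_pos by blast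
  have "norm (V x) \<le> c * norm x powr - \<beta>" if x: "norm x \<ge> 2 * max T0 b + 1" for x
  proof -
    define R where "R = norm x / 2"
    have R: "R > 0" "R > b" "R \<ge> T0" using x b by (auto simp: R_def)
    have far: "R \<le> norm y" if "y \<in> cball x R" for y
      using that norm_triangle_ineq2[of x y] by (simp add: R_def dist_norm)
    then have "cball x R \<subseteq> {y. R \<le> norm y} - K" using b R by force
    from small[OF R(1) this T0[OF R(3)]] have "norm x powr \<beta> * norm (V x) < c"
      using R by (simp add: R_def powr_divide divide_less_cancel)
    then show ?thesis using R by (simp add: R_def powr_minus field_simps)
  qed
  then show ?thesis unfolding eventually_at_infinity by blast
qed

end

section \<open>Comparison in exterior domains\<close>

text \<open>The norm of \<open>V\<close> need not be differentiable, but at a maximum \<open>z\<close> of \<open>|V|/\<phi>\<close> it can be replaced by the differentiable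
  function \<open>e \<bullet> V\<close> with \<open>e = V(z)/|V(z)|\<close>: it lies below \<open>|V|\<close> and agrees with it at \<open>z\<close>. Hence a multiple of \<open>\<phi>\<close>
  touches it from above at \<open>z\<close>, which is incompatible with \<open>\<phi>\<close> being a strict supersolution.\<close>
theorem comparison_principle_exterior:
  fixes V :: "real^'n::finite \<Rightarrow> real^'m::finite" and \<phi> :: "real^'n \<Rightarrow> real"
  assumes cont: "continuous_on {x. R \<le> norm x} V" "continuous_on {x. R \<le> norm x} \<phi>"
    and V: "\<And>j. has_second_partials {x. R < norm x} (\<lambda>x. V x $ j) (G j) (H j)"
    and \<phi>: "has_second_partials {x. R < norm x} \<phi> G\<phi> H\<phi>"
    and subsolution: "\<And>x. R < norm x \<Longrightarrow> norm (\<chi> j. \<Sum>i\<in>UNIV. H j i x) \<le> \<kappa> x * norm (V x)"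
    and supersolution: "\<And>x. R < norm x \<Longrightarrow> (\<Sum>i\<in>UNIV. H\<phi> i x) + \<kappa> x * \<phi> x < 0"
    and pos: "\<And>x. R \<le> norm x \<Longrightarrow> \<phi> x > 0"
    and infinity: "\<And>\<epsilon>. \<epsilon> > 0 \<Longrightarrow> \<forall>\<^sub>F x in at_infinity. norm (V x) \<le> \<epsilon> * \<phi> x"
    and sphere: "\<And>x. norm x = R \<Longrightarrow> norm (V x) \<le> t * \<phi> x" and t: "t \<ge> 0"
    and x: "R \<le> norm x"
  shows "norm (V x) \<le> t * \<phi> x"
proof (rule ccontr)
  assume not: "\<not> norm (V x) \<le> t * \<phi> x"
  define h where "h y = norm (V y) / \<phi> y" for y
  have hx: "t < h x" using not pos[OF x] by (simp add: h_def pos_less_divide_eq)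
  have "\<forall>\<^sub>F y in at_infinity. norm (V y) \<le> h x / 2 * \<phi> y"
    using hx t by (intro infinity) simp
  then obtain R1 where R1: "\<And>y. R1 \<le> norm y \<Longrightarrow> norm (V y) \<le> h x / 2 * \<phi> y"
    unfolding eventually_at_infinity by blast
  define A where "A = {y::real^'n. R \<le> norm y} \<inter> cball 0 (max R1 (norm x))"
  have "closed {y::real^'n. R \<le> norm y}" by (intro closed_Collect_le continuous_intros)
  then have "compact A" unfolding A_def by (intro closed_Int_compact compact_cball)
  moreover have xA: "x \<in> A" using x by (simp add: A_def)
  moreover have "continuous_on A h"
    unfolding h_def
    by (intro continuous_intros continuous_on_subset[OF cont(1)] continuous_on_subset[OF cont(2)])
      (use pos in \<open>force simp: A_def\<close>)+
  ultimately obtain z where z: "z \<in> A" and zmax: "\<And>y. y \<in> A \<Longrightarrow> h y \<le> h z"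
    using continuous_attains_sup[of A h] by blast
  have hz: "t < h z" using zmax[OF xA] hx by simp
  have max: "h y \<le> h z" if y: "R \<le> norm y" for y
  proof (cases "y \<in> A")
    case False
    then have "R1 \<le> norm y" using y by (auto simp: A_def)
    then have "h y \<le> h x / 2" using R1 pos[OF y] by (simp add: h_def pos_divide_le_eq)
    also have "\<dots> \<le> h z" using zmax[OF xA] hx t by simp
    finally show ?thesis .
  qed (rule zmax)
  have zR: "R < norm z"
  proof -
    have "R \<le> norm z" using z by (simp add: A_def)
    moreover have "norm z \<noteq> R"
    proof
      assume "norm z = R"
      then have "h z \<le> t" using sphere[of z] pos[of z] by (simp add: h_def pos_divide_le_eq)
      then show False using hz by simp
    qed
    ultimately show ?thesis by simp
  qed
  have Vz: "norm (V z) = h z * \<phi> z" "V z \<noteq> 0"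
    using pos[of z] zR hz t by (auto simp: h_def)
  \<comment> \<open>The linear functional that detects \<open>|V|\<close> at \<open>z\<close>.\<close>
  define e where "e = (1 / norm (V z)) *\<^sub>R V z"
  have e: "norm e = 1" "inner e (V z) = norm (V z)"
    using Vz(2) by (auto simp: e_def power2_norm_eq_inner[symmetric] power2_eq_square)
  define g where "g y = h z * \<phi> y + -1 * (\<Sum>j\<in>UNIV. e $ j * V y $ j)" for y
  have g_eq: "g y = h z * \<phi> y - inner e (V y)" for y by (simp add: g_def inner_vec_def)
  have g2: "has_second_partials {x. R < norm x} g
     (\<lambda>i y. h z * G\<phi> i y + -1 * (\<Sum>j\<in>UNIV. e $ j * G j i y))
     (\<lambda>i y. h z * H\<phi> i y + -1 * (\<Sum>j\<in>UNIV. e $ j * H j i y))"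
    unfolding g_def
    by (intro has_second_partials_add has_second_partials_cmult has_second_partials_sum V \<phi>)
  have "open {y::real^'n. R < norm y}" by (intro open_Collect_less continuous_intros)
  have "0 \<le> (\<Sum>i\<in>UNIV. h z * H\<phi> i z + -1 * (\<Sum>j\<in>UNIV. e $ j * H j i z))"
  proof (intro sum_nonneg second_partial_nonneg_at_min[OF g2])
    show "open {y::real^'n. R < norm y}" by fact
    show "g z \<le> g y" if "y \<in> {x. R < norm x}" for y
    proof -
      have y: "R \<le> norm y" using that by simp
      have "inner e (V y) \<le> norm (V y)" using norm_cauchy_schwarz[of e "V y"] e by simp
      also have "\<dots> \<le> h z * \<phi> y" using max[OF y] pos[OF y] by (simp add: h_def[of y] pos_divide_le_eq)
      finally show ?thesis by (simp add: g_eq e Vz(1))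
    qed
  qed (use zR in simp)
  also have "\<dots> = h z * (\<Sum>i\<in>UNIV. H\<phi> i z) - inner e (\<chi> j. \<Sum>i\<in>UNIV. H j i z)"
  proof -
    have "(\<Sum>i\<in>UNIV. \<Sum>j\<in>UNIV. e $ j * H j i z) = inner e (\<chi> j. \<Sum>i\<in>UNIV. H j i z)"
      by (subst sum.swap) (simp add: inner_vec_def sum_distrib_left)
    then show ?thesis by (simp add: sum.distrib sum_subtractf sum_negf sum_distrib_left)
  qed
  also have "\<dots> \<le> h z * (\<Sum>i\<in>UNIV. H\<phi> i z) + \<kappa> z * (h z * \<phi> z)"
    using norm_cauchy_schwarz[of "- e" "\<chi> j. \<Sum>i\<in>UNIV. H j i z"] subsolution[OF zR] e(1) Vz(1)
    by simp
  also have "\<dots> = h z * ((\<Sum>i\<in>UNIV. H\<phi> i z) + \<kappa> z * \<phi> z)" by (simp add: algebra_simps)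
  also have "\<dots> < 0" using hz t supersolution[OF zR] by (intro mult_pos_neg) auto
  finally show False by simp
qed

text \<open>This removes from the bounds the term that makes the supersolutions dominate \<open>V\<close> at infinity.\<close>
lemma le_if_le_add_small_mult:
  fixes a b c :: real
  assumes "\<And>\<eta>. \<eta> > 0 \<Longrightarrow> a \<le> b + \<eta> * c"
  shows "a \<le> b"
proof (rule field_le_epsilon)
  fix e :: real assume e: "e > 0"
  have "a \<le> b + e / (\<bar>c\<bar> + 1) * c" using e by (intro assms) simp
  also have "e / (\<bar>c\<bar> + 1) * c \<le> e / (\<bar>c\<bar> + 1) * (\<bar>c\<bar> + 1)" using e by (intro mult_left_mono) auto
  finally show "a \<le> b + e" by simp
qed

section \<open>Optimal decay\<close>

context critical_exterior_solution
begin

lemma exterior_radius: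
  obtains b where "b > 0" "\<And>y. b \<le> norm y \<Longrightarrow> y \<notin> K"
proof -
  obtain b where b: "b > 0" "\<forall>y\<in>K. norm y \<le> b"
    using compact_imp_bounded[OF K] unfolding bounded_pos by blast
  show thesis
  proof (rule that[of "b + 1"])
    show "y \<notin> K" if "b + 1 \<le> norm y" for y
      using bspec[OF b(2), of y] that by linarith
  qed (use b in simp)
qed

lemma sphere_bound:
  assumes "\<And>y. R \<le> norm y \<Longrightarrow> y \<notin> K"
  obtains m where "m \<ge> 0" "\<And>x. norm x = R \<Longrightarrow> norm (V x) \<le> m"
proof -
  have "compact (V ` sphere 0 R)"
    by (intro compact_continuous_image continuous_on_subset[OF continuous_V] compact_sphere)
      (use assms in auto)
  then have "bounded (V ` sphere 0 R)" by (rule compact_imp_bounded)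
  then obtain m where m: "m > 0" "\<forall>y\<in>V ` sphere 0 R. norm y \<le> m"
    unfolding bounded_pos by blast
  show thesis
  proof (rule that[of m])
    show "norm (V x) \<le> m" if "norm x = R" for x
      using bspec[OF m(2), of "V x"] that by simp
  qed (use m in simp)
qed

lemma V_comparison:
  assumes R: "R > 0" "\<And>y. R \<le> norm y \<Longrightarrow> y \<notin> K"
    and cont: "continuous_on {x. R \<le> norm x} \<phi>"
    and \<phi>: "has_second_partials (- {0}) \<phi> G\<phi> H\<phi>"
    and supersolution: "\<And>x. R < norm x \<Longrightarrow>
      (\<Sum>i\<in>UNIV. H\<phi> i x) + B * norm (V x) powr (q - 1) * \<phi> x < 0"
    and pos: "\<And>x. R \<le> norm x \<Longrightarrow> \<phi> x > 0"
    and infinity: "\<And>\<epsilon>. \<epsilon> > 0 \<Longrightarrow> \<forall>\<^sub>F x in at_infinity. norm (V x) \<le> \<epsilon> * \<phi> x"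
    and sphere: "\<And>x. norm x = R \<Longrightarrow> norm (V x) \<le> t * \<phi> x" and t: "t \<ge> 0"
    and x: "R \<le> norm x"
  shows "norm (V x) \<le> t * \<phi> x"
proof (rule comparison_principle_exterior[OF _ cont _ _ _ supersolution pos infinity sphere t x])
  have "{x. R \<le> norm x} \<subseteq> - K" using R(2) by auto
  then show "continuous_on {x. R \<le> norm x} V" by (rule continuous_on_subset[OF continuous_V])
  show "has_second_partials {x. R < norm x} \<phi> G\<phi> H\<phi>"
    by (rule has_second_partials_subset[OF \<phi>]) (use R(1) in auto)
  show "has_second_partials {x. R < norm x} (\<lambda>x. V x $ j) (\<lambda>i. partial_deriv i (\<lambda>x. V x $ j))
    (\<lambda>i. partial_deriv i (partial_deriv i (\<lambda>x. V x $ j)))" for j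
    by (rule has_second_partials_subset[OF second_partials_V]) (use R(2) in \<open>auto simp: less_imp_le\<close>)
  fix y :: "real^'n" assume y: "R < norm y"
  have "norm (\<chi> j. \<Sum>i\<in>UNIV. partial_deriv i (partial_deriv i (\<lambda>x. V x $ j)) y) \<le> B * norm (V y) powr q"
    using laplacian_bound[of y] R(2)[of y] y unfolding sum_second_partials_V by simp
  also have "norm (V y) powr q = norm (V y) powr (q - 1) * norm (V y)"
    using powr_add[of "norm (V y)" "q - 1" 1] by simp
  finally show "norm (\<chi> j. \<Sum>i\<in>UNIV. partial_deriv i (partial_deriv i (\<lambda>x. V x $ j)) y)
    \<le> B * norm (V y) powr (q - 1) * norm (V y)" by simp
qed

lemma V_eventually_le:
  assumes "a \<le> \<beta>" "c > 0"
  shows "\<forall>\<^sub>F x in at_infinity. norm (V x) \<le> c * norm x powr - a"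
proof -
  have "\<forall>\<^sub>F x in at_infinity. 1 \<le> norm (x :: real^'n)"
    unfolding eventually_at_infinity by blast
  with V_little_o[OF assms(2)] show ?thesis
  proof eventually_elim
    case (elim x)
    have "c * norm x powr - \<beta> \<le> c * norm x powr - a"
      using elim assms by (intro mult_left_mono powr_mono) auto
    then show ?case using elim by simp
  qed
qed

lemma continuous_on_norm_powr:
  "R > 0 \<Longrightarrow> continuous_on {x::real^'n. R \<le> norm x} (\<lambda>x. norm x powr a)"
  by (intro continuous_intros) auto

text \<open>Writing \<open>|V|\<^sup>q = |V|^(q-1) |V|\<close> turns the nonlinearity into a linear term with a potential. Since
  \<open>\<beta>(q - 1) = 2\<close>, the scale-invariant decay of \<open>V\<close> makes it smaller, near infinity, than any positive
  multiple of \<open>|x|^(-2)\<close>.\<close>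
lemma potential_eventually_small:
  assumes "D > 0"
  shows "\<forall>\<^sub>F x in at_infinity. B * norm (V x) powr (q - 1) < D * norm x powr - 2"
proof -
  \<comment> \<open>Then \<open>B c^(q-1)\<close> is at most \<open>D/2\<close>; adding \<open>1\<close> to \<open>B\<close> covers \<open>B = 0\<close>.\<close>
  define c where "c = (D / (2 * (B + 1))) powr (1 / (q - 1))"
  have c: "c > 0" using assms B by (simp add: c_def)
  have "c powr (q - 1) = D / (2 * (B + 1))" using q assms B by (simp add: c_def powr_powr)
  then have Bc: "B * c powr (q - 1) < D"
  proof -
    have "0 \<le> B * D" using B assms by simp
    then have "B * D < D * (2 * (B + 1))" using assms by (simp add: algebra_simps)
    then show ?thesis using \<open>c powr (q - 1) = _\<close> B by (simp add: pos_divide_less_eq)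
  qed
  have "\<forall>\<^sub>F x in at_infinity. 1 \<le> norm (x :: real^'n)"
    unfolding eventually_at_infinity by blast
  with V_little_o[OF c] show ?thesis
  proof eventually_elim
    case (elim x)
    have "norm (V x) powr (q - 1) \<le> (c * norm x powr - \<beta>) powr (q - 1)"
      using elim q by (intro powr_mono2) auto
    also have "\<dots> = c powr (q - 1) * norm x powr - 2"
      using c \<beta>_times_q by (simp add: powr_mult powr_powr)
    finally have "B * norm (V x) powr (q - 1) \<le> B * c powr (q - 1) * norm x powr - 2"
      using B by (simp add: mult_left_mono mult.assoc)
    also have "\<dots> < D * norm x powr - 2"
      using Bc elim by (intro mult_strict_right_mono) auto
    finally show ?case .
  qed
qed

text \<open>The exponents \<open>a = n - 2 - \<delta>\<close> and \<open>\<delta>\<close> add up to \<open>n - 2\<close>, so both powers produce the same factor \<open>-D\<close> with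
  \<open>D = \<delta>a\<close>, and a potential below \<open>D|x|^(-2)\<close> leaves their combination a strict supersolution. The slower one
  dominates \<open>V\<close> at infinity since \<open>\<delta> \<le> \<beta>\<close>.\<close>
lemma V_almost_optimal_decay:
  assumes \<delta>: "0 < \<delta>" "\<delta> < real CARD('n) - 2" "\<delta> \<le> \<beta>"
  obtains R c where "R > 0" "c \<ge> 0"
    "\<And>x. R \<le> norm x \<Longrightarrow> norm (V x) \<le> c * norm x powr - (real CARD('n) - 2 - \<delta>)"
proof -
  let ?n = "real CARD('n)"
  define a where "a = ?n - 2 - \<delta>"
  define D where "D = \<delta> * a"
  have a: "a > 0" and D: "D > 0" using \<delta> by (auto simp: a_def D_def)
  obtain R1 where R1: "\<And>x. R1 \<le> norm x \<Longrightarrow> B * norm (V x) powr (q - 1) < D * norm x powr - 2"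
    using potential_eventually_small[OF D] unfolding eventually_at_infinity by blast
  obtain b where b: "b > 0" "\<And>y. b \<le> norm y \<Longrightarrow> y \<notin> K" using exterior_radius by blast
  define R where "R = max R1 b"
  have R: "R > 0" using b by (simp add: R_def)
  have RK: "y \<notin> K" if "R \<le> norm y" for y using b that by (simp add: R_def)
  obtain m where m: "m \<ge> 0" "\<And>x. norm x = R \<Longrightarrow> norm (V x) \<le> m" using sphere_bound[OF RK] by blast
  define t where "t = m * R powr a"
  have t: "t \<ge> 0" using m by (simp add: t_def)
  have "norm (V x) \<le> t * norm x powr - a" if x: "R \<le> norm x" for x
  proof (rule le_if_le_add_small_mult)
    fix \<eta> :: real assume \<eta>: "\<eta> > 0"
    define \<phi> where "\<phi> y = norm y powr - a + \<eta> * norm y powr - \<delta>" for y :: "real^'n"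
    have \<phi>2: "has_second_partials (- {0}) \<phi>
      (\<lambda>i y. partial_norm_powr (- a) i y + \<eta> * partial_norm_powr (- \<delta>) i y)
      (\<lambda>i y. second_partial_norm_powr (- a) i y + \<eta> * second_partial_norm_powr (- \<delta>) i y)"
      unfolding \<phi>_def
      by (intro has_second_partials_add has_second_partials_cmult has_second_partials_norm_powr)
    have "norm (V x) \<le> t * \<phi> x"
    proof (rule V_comparison[OF R RK _ \<phi>2 _ _ _ _ t x])
      show "continuous_on {x. R \<le> norm x} \<phi>"
        unfolding \<phi>_def using R by (intro continuous_intros continuous_on_norm_powr)
      show "\<phi> y > 0" if "R \<le> norm y" for y
        using that R \<eta> by (auto simp: \<phi>_def intro!: add_pos_pos mult_pos_pos)
      show "\<forall>\<^sub>F y in at_infinity. norm (V y) \<le> \<epsilon> * \<phi> y" if "\<epsilon> > 0" for \<epsilon>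
      proof (rule eventually_mono[OF V_eventually_le[OF \<delta>(3), of "\<epsilon> * \<eta>"]])
        fix y assume "norm (V y) \<le> \<epsilon> * \<eta> * norm y powr - \<delta>"
        also have "\<dots> \<le> \<epsilon> * \<phi> y" using that by (simp add: \<phi>_def algebra_simps)
        finally show "norm (V y) \<le> \<epsilon> * \<phi> y" .
      qed (use that \<eta> in simp)
      show "norm (V y) \<le> t * \<phi> y" if y: "norm y = R" for y
      proof -
        have "norm (V y) \<le> m" using m y by simp
        also have "\<dots> = t * norm y powr - a" using R y by (simp add: t_def powr_minus)
        also have "\<dots> \<le> t * \<phi> y" using t \<eta> by (intro mult_left_mono) (auto simp: \<phi>_def)
        finally show ?thesis .
      qed
      fix y :: "real^'n" assume y: "R < norm y"
      then have y0: "y \<noteq> 0" using R by auto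
      have "(\<Sum>i\<in>UNIV. second_partial_norm_powr (- a) i y + \<eta> * second_partial_norm_powr (- \<delta>) i y)
        = - a * (- a + ?n - 2) * norm y powr (- a - 2) + \<eta> * (- \<delta> * (- \<delta> + ?n - 2) * norm y powr (- \<delta> - 2))"
        by (simp only: sum.distrib sum_distrib_left[symmetric] laplacian_norm_powr[OF y0])
      also have "\<dots> = - (D * norm y powr - 2) * \<phi> y"
      proof -
        have pw: "norm y powr (c - 2) = norm y powr - 2 * norm y powr c" for c
          using powr_add[of "norm y" "-2" c] by simp
        have coef: "- a * (- a + ?n - 2) = - D" "- \<delta> * (- \<delta> + ?n - 2) = - D"
          by (simp_all add: D_def a_def algebra_simps)
        show ?thesis unfolding pw coef \<phi>_def by (simp add: algebra_simps)
      qed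
      finally have eq: "(\<Sum>i\<in>UNIV. second_partial_norm_powr (- a) i y + \<eta> * second_partial_norm_powr (- \<delta>) i y) = - (D * norm y powr - 2) * \<phi> y" .
      have "\<phi> y > 0" using y0 \<eta> by (auto simp: \<phi>_def intro!: add_pos_pos mult_pos_pos)
      moreover have "B * norm (V y) powr (q - 1) < D * norm y powr - 2"
        using R1 y by (simp add: R_def)
      ultimately have "B * norm (V y) powr (q - 1) * \<phi> y < D * norm y powr - 2 * \<phi> y" by simp
      then show "(\<Sum>i\<in>UNIV. second_partial_norm_powr (- a) i y + \<eta> * second_partial_norm_powr (- \<delta>) i y)
         + B * norm (V y) powr (q - 1) * \<phi> y < 0"
        unfolding eq by simp
    qed
    then show "norm (V x) \<le> t * norm x powr - a + \<eta> * (t * norm x powr - \<delta>)"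
      by (simp add: \<phi>_def algebra_simps)
  qed
  then show thesis using that[OF R t] by (simp add: a_def)
qed

text \<open>For \<open>\<delta>\<close> small the almost optimal decay makes the potential \<open>O(|x|^(-2-\<sigma>))\<close>. Its action on \<open>|x|^(-a)\<close>, where
  \<open>a = n - 2\<close>, is then of order \<open>|x|^(-a-2-\<sigma>)\<close>, the order of the Laplacian of \<open>|x|^(-a-\<sigma>)\<close>, which is positive.
  Subtracting \<open>\<mu>|x|^(-a-\<sigma>)\<close> therefore absorbs the potential.\<close>
lemma V_optimal_decay_supercritical:
  assumes super: "(q - 1) * (real CARD('n) - 2) > 2"
  obtains R c where "R > 0" "c \<ge> 0"
    "\<And>x. R \<le> norm x \<Longrightarrow> norm (V x) \<le> c * norm x powr - (real CARD('n) - 2)"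
proof -
  let ?n = "real CARD('n)"
  \<comment> \<open>Half of the excess of \<open>(q-1)(n-2)\<close> over \<open>2\<close>; the other half pays for the loss \<open>\<delta>\<close> in the almost optimal decay.\<close>
  define \<sigma> where "\<sigma> = ((q - 1) * (?n - 2) - 2) / 2"
  define \<delta> where "\<delta> = min \<beta> (min ((?n - 2) / 2) (\<sigma> / (q - 1)))"
  have n: "?n \<ge> 3" using dim by simp
  have \<sigma>: "\<sigma> > 0" using super by (simp add: \<sigma>_def)
  have \<delta>: "0 < \<delta>" "\<delta> < ?n - 2" "\<delta> \<le> \<beta>" and \<delta>\<sigma>: "\<delta> * (q - 1) \<le> \<sigma>"
  proof -
    show "0 < \<delta>" using \<beta>_pos \<sigma> q n by (simp add: \<delta>_def)
    have "\<delta> \<le> (?n - 2) / 2" unfolding \<delta>_def by (intro min.coboundedI2 min.cobounded1)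
    then show "\<delta> < ?n - 2" using n by simp
    show "\<delta> \<le> \<beta>" by (simp add: \<delta>_def)
    have "\<delta> \<le> \<sigma> / (q - 1)" unfolding \<delta>_def by (intro min.coboundedI2 min.cobounded2)
    then show "\<delta> * (q - 1) \<le> \<sigma>" using q by (simp add: pos_le_divide_eq)
  qed
  obtain R0 c where R0: "R0 > 0" and c: "c \<ge> 0"
    and decay: "\<And>x. R0 \<le> norm x \<Longrightarrow> norm (V x) \<le> c * norm x powr - (?n - 2 - \<delta>)"
    using V_almost_optimal_decay[OF \<delta>] by blast
  define k where "k = B * c powr (q - 1)"
  have k: "k \<ge> 0" using B by (simp add: k_def)
  have potential: "B * norm (V x) powr (q - 1) \<le> k * norm x powr (- 2 - \<sigma>)"
    if "R0 \<le> norm x" "1 \<le> norm x" for x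
  proof -
    have "norm (V x) powr (q - 1) \<le> (c * norm x powr - (?n - 2 - \<delta>)) powr (q - 1)"
      using decay[OF that(1)] q by (intro powr_mono2) auto
    also have "\<dots> = c powr (q - 1) * norm x powr (- (?n - 2 - \<delta>) * (q - 1))"
      using c by (simp add: powr_mult powr_powr)
    also have "\<dots> \<le> c powr (q - 1) * norm x powr (- 2 - \<sigma>)"
    proof (intro mult_left_mono powr_mono)
      have "2 * \<sigma> = (q - 1) * (?n - 2) - 2" by (simp add: \<sigma>_def)
      then show "- (?n - 2 - \<delta>) * (q - 1) \<le> - 2 - \<sigma>" using \<delta>\<sigma> by (simp add: algebra_simps)
    qed (use that in auto)
    finally show ?thesis using B by (simp add: k_def mult_left_mono mult.assoc)
  qed
  define a where "a = ?n - 2"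
  define E where "E = \<sigma> * (a + \<sigma>)"
  define D where "D = \<delta> * (a - \<delta>)"
  define \<mu> where "\<mu> = (k + 1) / E"
  have E: "E > 0" and D: "D > 0" using \<delta> \<sigma> n by (auto simp: E_def D_def a_def)
  have \<mu>: "\<mu> > 0" "\<mu> * E = k + 1" using k E by (auto simp: \<mu>_def)
  obtain b where b: "b > 0" "\<And>y. b \<le> norm y \<Longrightarrow> y \<notin> K" using exterior_radius by blast
  \<comment> \<open>With \<open>|x|\<^sup>\<sigma> \<ge> w\<close> the subtracted term is at most half of \<open>|x|^(-a)\<close>, and the potential is below \<open>D|x|^(-2)\<close>, as
      the auxiliary term \<open>\<eta>|x|^(-\<delta>)\<close> requires.\<close>
  define w where "w = max (2 * \<mu>) ((k + 1) / D)"
  have w: "w > 0" "2 * \<mu> \<le> w" "k < w * D"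
  proof -
    show "w > 0" "2 * \<mu> \<le> w" using \<mu> by (auto simp: w_def)
    have "(k + 1) / D \<le> w" by (simp add: w_def)
    then have "k + 1 \<le> w * D" using D by (simp add: pos_divide_le_eq)
    then show "k < w * D" by simp
  qed
  define R where "R = max (max R0 b) (max 1 (w powr (1 / \<sigma>)))"
  have R: "R > 0" "R0 \<le> R" "1 \<le> R" using R0 by (auto simp: R_def)
  have RK: "y \<notin> K" if "R \<le> norm y" for y using b that by (simp add: R_def)
  have far: "norm y powr - \<sigma> \<le> 1 / w" if "R \<le> norm y" for y :: "real^'n"
  proof -
    have "w powr (1 / \<sigma>) \<le> norm y" using that by (simp add: R_def)
    then have "(w powr (1 / \<sigma>)) powr \<sigma> \<le> norm y powr \<sigma>" using \<sigma> by (intro powr_mono2) auto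
    then have "w \<le> norm y powr \<sigma>" using w \<sigma> by (simp add: powr_powr)
    then show ?thesis using w by (simp add: powr_minus frac_le inverse_eq_divide)
  qed
  obtain m where m: "m \<ge> 0" "\<And>x. norm x = R \<Longrightarrow> norm (V x) \<le> m" using sphere_bound[OF RK] by blast
  define t where "t = 2 * m * R powr a"
  have t: "t \<ge> 0" using m by (simp add: t_def)
  have "norm (V x) \<le> t * norm x powr - a" if x: "R \<le> norm x" for x
  proof (rule le_if_le_add_small_mult)
    fix \<eta> :: real assume \<eta>: "\<eta> > 0"
    define \<phi> where "\<phi> y = norm y powr - a + ((- \<mu>) * norm y powr - (a + \<sigma>) + \<eta> * norm y powr - \<delta>)" for y :: "real^'n"
    have \<phi>2: "has_second_partials (- {0}) \<phi>
      (\<lambda>i y. partial_norm_powr (- a) i y +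
         ((- \<mu>) * partial_norm_powr (- (a + \<sigma>)) i y + \<eta> * partial_norm_powr (- \<delta>) i y))
      (\<lambda>i y. second_partial_norm_powr (- a) i y +
         ((- \<mu>) * second_partial_norm_powr (- (a + \<sigma>)) i y + \<eta> * second_partial_norm_powr (- \<delta>) i y))"
      unfolding \<phi>_def
      by (intro has_second_partials_add has_second_partials_cmult has_second_partials_norm_powr)
    have pw\<sigma>: "norm y powr - (a + \<sigma>) = norm y powr - a * norm y powr - \<sigma>" for y :: "real^'n"
      using powr_add[of "norm y" "- a" "- \<sigma>"] by simp
    have \<phi>_lower: "norm y powr - a / 2 + \<eta> * norm y powr - \<delta> \<le> \<phi> y" if "R \<le> norm y" for y
    proof -
      have "\<mu> * norm y powr - \<sigma> \<le> \<mu> * (1 / w)" using far[OF that] \<mu> by (intro mult_left_mono) auto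
      also have "\<dots> \<le> 1 / 2" using w \<mu> by (simp add: field_simps)
      finally have "norm y powr - a * (\<mu> * norm y powr - \<sigma>) \<le> norm y powr - a * (1/2)"
        by (intro mult_left_mono) auto
      then show ?thesis unfolding \<phi>_def pw\<sigma> by (simp add: mult_ac)
    qed
    have \<phi>_upper: "\<phi> y \<le> norm y powr - a + \<eta> * norm y powr - \<delta>" for y
      using \<mu> by (simp add: \<phi>_def)
    have "norm (V x) \<le> t * \<phi> x"
    proof (rule V_comparison[OF R(1) RK _ \<phi>2 _ _ _ _ t x])
      show "continuous_on {x. R \<le> norm x} \<phi>"
        unfolding \<phi>_def using R by (intro continuous_intros continuous_on_norm_powr)
      show "\<phi> y > 0" if y: "R \<le> norm y" for y
      proof -
        have "0 < norm y powr - a / 2 + \<eta> * norm y powr - \<delta>"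
          using y R \<eta> by (intro add_pos_pos mult_pos_pos) auto
        then show ?thesis using \<phi>_lower[OF y] by simp
      qed
      show "\<forall>\<^sub>F y in at_infinity. norm (V y) \<le> \<epsilon> * \<phi> y" if \<epsilon>: "\<epsilon> > 0" for \<epsilon>
      proof -
        have "\<forall>\<^sub>F y in at_infinity. R \<le> norm (y :: real^'n)"
          unfolding eventually_at_infinity by blast
        moreover have "\<forall>\<^sub>F y in at_infinity. norm (V y) \<le> \<epsilon> * \<eta> * norm y powr - \<delta>"
          using \<epsilon> \<eta> by (intro V_eventually_le \<delta>(3)) simp
        ultimately show ?thesis
        proof eventually_elim
          case (elim y)
          have "\<eta> * norm y powr - \<delta> \<le> norm y powr - a / 2 + \<eta> * norm y powr - \<delta>" by simp
          also have "\<dots> \<le> \<phi> y" using \<phi>_lower elim by simp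
          finally have "\<epsilon> * (\<eta> * norm y powr - \<delta>) \<le> \<epsilon> * \<phi> y" using \<epsilon> by (intro mult_left_mono) auto
          then show ?case using elim by (simp add: mult.assoc)
        qed
      qed
      show "norm (V y) \<le> t * \<phi> y" if y: "norm y = R" for y
      proof -
        have "norm (V y) \<le> m" using m y by simp
        also have "m = t * (norm y powr - a / 2)" using R y by (simp add: t_def powr_minus)
        also have "\<dots> \<le> t * \<phi> y"
        proof (intro mult_left_mono t)
          have "norm y powr - a / 2 \<le> norm y powr - a / 2 + \<eta> * norm y powr - \<delta>" using \<eta> by simp
          also have "\<dots> \<le> \<phi> y" using \<phi>_lower[of y] y by simp
          finally show "norm y powr - a / 2 \<le> \<phi> y" .
        qed
        finally show ?thesis .
      qed
      fix y :: "real^'n" assume y: "R < norm y"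
      then have y0: "y \<noteq> 0" using R by auto
      have pw: "norm y powr (d - 2) = norm y powr - 2 * norm y powr d" for d
        using powr_add[of "norm y" "-2" d] by simp
      have "(\<Sum>i\<in>UNIV. second_partial_norm_powr (- a) i y +
         ((- \<mu>) * second_partial_norm_powr (- (a + \<sigma>)) i y + \<eta> * second_partial_norm_powr (- \<delta>) i y))
        = - a * (- a + ?n - 2) * norm y powr (- a - 2) +
          ((- \<mu>) * (- (a + \<sigma>) * (- (a + \<sigma>) + ?n - 2) * norm y powr (- (a + \<sigma>) - 2)) +
           \<eta> * (- \<delta> * (- \<delta> + ?n - 2) * norm y powr (- \<delta> - 2)))"
        by (simp only: sum.distrib sum_distrib_left[symmetric] laplacian_norm_powr[OF y0])
      also have "\<dots> = - (norm y powr - 2) * ((\<mu> * E) * (norm y powr - a * norm y powr - \<sigma>) + \<eta> * D * norm y powr - \<delta>)"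
      proof -
        have coef: "- a * (- a + ?n - 2) = 0" "- (a + \<sigma>) * (- (a + \<sigma>) + ?n - 2) = E"
          "- \<delta> * (- \<delta> + ?n - 2) = - D"
          by (simp_all add: E_def D_def a_def algebra_simps)
        show ?thesis unfolding pw coef pw\<sigma> by (simp add: algebra_simps)
      qed
      finally have eq: "(\<Sum>i\<in>UNIV. second_partial_norm_powr (- a) i y +
         ((- \<mu>) * second_partial_norm_powr (- (a + \<sigma>)) i y + \<eta> * second_partial_norm_powr (- \<delta>) i y))
        = - (norm y powr - 2) * ((\<mu> * E) * (norm y powr - a * norm y powr - \<sigma>) + \<eta> * D * norm y powr - \<delta>)" .
      have "B * norm (V y) powr (q - 1) * \<phi> y
        \<le> k * norm y powr (- 2 - \<sigma>) * (norm y powr - a + \<eta> * norm y powr - \<delta>)"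
      proof (rule mult_mono)
        show "B * norm (V y) powr (q - 1) \<le> k * norm y powr (- 2 - \<sigma>)"
          using R y by (intro potential) auto
        have "0 \<le> norm y powr - a / 2 + \<eta> * norm y powr - \<delta>" using \<eta> by simp
        then show "0 \<le> \<phi> y" using \<phi>_lower y by (meson less_imp_le order_trans)
      qed (use k \<phi>_upper in auto)
      also have "\<dots> = norm y powr - 2 * (k * (norm y powr - a * norm y powr - \<sigma>) + \<eta> * (k * norm y powr - \<sigma>) * norm y powr - \<delta>)"
      proof -
        have "norm y powr (- 2 - \<sigma>) = norm y powr - 2 * norm y powr - \<sigma>"
          by (simp flip: powr_add)
        then show ?thesis by (simp only: algebra_simps)
      qed
      also have "\<dots> < norm y powr - 2 * ((\<mu> * E) * (norm y powr - a * norm y powr - \<sigma>) + \<eta> * D * norm y powr - \<delta>)"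
      proof (intro mult_strict_left_mono add_less_le_mono mult_strict_right_mono mult_right_mono mult_left_mono)
        have "k * norm y powr - \<sigma> \<le> k * (1 / w)" using far y k by (intro mult_left_mono) auto
        also have "\<dots> \<le> D" using w by (simp add: field_simps)
        finally show "k * norm y powr - \<sigma> \<le> D" .
      qed (use y0 \<mu> \<eta> in auto)
      finally show "(\<Sum>i\<in>UNIV. second_partial_norm_powr (- a) i y +
         ((- \<mu>) * second_partial_norm_powr (- (a + \<sigma>)) i y + \<eta> * second_partial_norm_powr (- \<delta>) i y))
         + B * norm (V y) powr (q - 1) * \<phi> y < 0"
        unfolding eq by simp
    qed
    also have "\<dots> \<le> t * (norm x powr - a + \<eta> * norm x powr - \<delta>)"
      using t \<phi>_upper by (intro mult_left_mono) auto
    finally show "norm (V x) \<le> t * norm x powr - a + \<eta> * (t * norm x powr - \<delta>)"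
      by (simp add: algebra_simps)
  qed
  then show thesis using that[OF R(1) t] by (simp add: a_def)
qed

lemma V_optimal_decay:
  obtains R c where "R > 0" "c \<ge> 0"
    "\<And>x. R \<le> norm x \<Longrightarrow> norm (V x) \<le> c * norm x powr - (real CARD('n) - 2)"
proof (cases "(q - 1) * (real CARD('n) - 2) > 2")
  case True
  then show thesis using V_optimal_decay_supercritical that by blast
next
  case False
  then have "real CARD('n) - 2 \<le> \<beta>"
    using q by (simp add: \<beta>_def pos_le_divide_eq mult.commute)
  then have "\<forall>\<^sub>F x in at_infinity. norm (V x) \<le> 1 * norm x powr - (real CARD('n) - 2)"
    by (rule V_eventually_le) simp
  then obtain R where "\<And>x. R \<le> norm x \<Longrightarrow> norm (V x) \<le> 1 * norm x powr - (real CARD('n) - 2)"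
    unfolding eventually_at_infinity by blast
  then show thesis by (intro that[of "max R 1" 1]) auto
qed

text \<open>On the ball of radius \<open>r = |x|/2\<close> both \<open>|V|\<close> and \<open>r\<^sup>2|\<Delta>V|\<close> are \<open>O(r^(-(n-2)))\<close>, the latter because the
  potential is \<open>O(r^(-2))\<close>. The interior gradient estimate divides by \<open>r\<close>.\<close>
lemma gradient_optimal_decay:
  obtains R c where "R > 0" "c \<ge> 0"
    "\<And>x i j. R \<le> norm x \<Longrightarrow>
      \<bar>partial_deriv i (\<lambda>y. V y $ j) x\<bar> \<le> c * norm x powr - (real CARD('n) - 1)"
proof -
  let ?n = "real CARD('n)"
  define a where "a = ?n - 2"
  have a: "a > 0" using dim by (simp add: a_def)
  obtain R0 c where R0: "R0 > 0" and c: "c \<ge> 0"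
    and decay: "\<And>x. R0 \<le> norm x \<Longrightarrow> norm (V x) \<le> c * norm x powr - a"
    using V_optimal_decay unfolding a_def by blast
  obtain R1 where R1: "\<And>x. R1 \<le> norm x \<Longrightarrow> B * norm (V x) powr (q - 1) < 1 * norm x powr - 2"
    using potential_eventually_small[of 1] unfolding eventually_at_infinity by auto
  obtain b where b: "b > 0" "\<And>y. b \<le> norm y \<Longrightarrow> y \<notin> K" using exterior_radius by blast
  define R where "R = 2 * max R0 (max R1 b)"
  define c' where "c' = (2 * ?n\<^sup>2 + 1 / ?n) * (c * 2 powr a)"
  have "\<bar>partial_deriv i (\<lambda>y. V y $ j) x\<bar> \<le> c' * norm x powr - (?n - 1)" if x: "R \<le> norm x" for x i j
  proof -
    define r where "r = norm x / 2"
    have r: "r > 0" "R0 \<le> r" "R1 \<le> r" "b \<le> r" using x R0 by (auto simp: r_def R_def)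
    define M where "M = c * r powr - a"
    have far: "r \<le> norm y" if "y \<in> cball x r" for y
      using that norm_triangle_ineq2[of x y] by (simp add: r_def dist_norm)
    have V_le: "norm (V y) \<le> M" if y: "y \<in> cball x r" for y
    proof -
      have "norm (V y) \<le> c * norm y powr - a" using decay far[OF y] r by simp
      also have "\<dots> \<le> M" unfolding M_def using far[OF y] r a c by (intro mult_left_mono powr_mono2') auto
      finally show ?thesis .
    qed
    have "\<bar>partial_deriv i (\<lambda>y. V y $ j) x\<bar> \<le> ?n\<^sup>2 / r * M + r / (2 * ?n) * (r powr - 2 * M)"
    proof (rule gradient_bound[OF r(1) _ V_le])
      show "cball x r \<subseteq> - K" using b far r by force
      show "norm (vector_laplacian V y) \<le> r powr - 2 * M" if y: "y \<in> cball x r" for y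
      proof -
        have "norm (vector_laplacian V y) \<le> B * norm (V y) powr q"
          using b(2)[of y] far[OF y] r by (intro laplacian_bound) auto
        also have "\<dots> = B * norm (V y) powr (q - 1) * norm (V y)"
          using powr_add[of "norm (V y)" "q - 1" 1] by simp
        also have "\<dots> \<le> r powr - 2 * M"
        proof (rule mult_mono[OF _ V_le[OF y]])
          have "B * norm (V y) powr (q - 1) \<le> norm y powr - 2" using R1[of y] far[OF y] r by simp
          also have "\<dots> \<le> r powr - 2" using far[OF y] r by (intro powr_mono2') auto
          finally show "B * norm (V y) powr (q - 1) \<le> r powr - 2" .
        qed auto
        finally show ?thesis .
      qed
    qed
    also have "r powr - 2 = 1 / r\<^sup>2" using r by (simp add: powr_minus_divide powr_numeral)
    also have "?n\<^sup>2 / r * M + r / (2 * ?n) * (1 / r\<^sup>2 * M) = (?n\<^sup>2 + 1 / (2 * ?n)) * (M / r)"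
      using r by (simp add: field_simps power2_eq_square)
    also have "M / r = 2 * (c * 2 powr a) * norm x powr - (?n - 1)"
    proof -
      have "norm x powr - (?n - 1) = norm x powr - a * norm x powr - 1"
        using powr_add[of "norm x" "- a" "- 1"] by (simp add: a_def)
      moreover have "norm x powr - 1 = 1 / norm x" using r by (simp add: powr_minus_divide)
      moreover have "r powr - a = 2 powr a * norm x powr - a"
        by (simp add: r_def powr_divide powr_minus field_simps)
      ultimately show ?thesis by (simp add: M_def r_def)
    qed
    also have "(?n\<^sup>2 + 1 / (2 * ?n)) * (2 * (c * 2 powr a) * norm x powr - (?n - 1)) = c' * norm x powr - (?n - 1)"
      by (simp add: c'_def algebra_simps)
    finally show ?thesis .
  qed
  moreover have "R > 0" "c' \<ge> 0" using R0 c by (auto simp: R_def c'_def)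
  ultimately show thesis using that by blast
qed

end

section \<open>From the system to the differential inequality\<close>

lemma invertible_if_positive_definite:
  assumes "positive_definite A"
  obtains A' where "A' ** A = mat 1"
proof -
  have "x = 0" if "A *v x = 0" for x
    using assms that unfolding positive_definite_def by (metis inner_zero_right less_irrefl)
  then show thesis using matrix_left_invertible_ker that by blast
qed

lemma norm_vector_laplacian_le:
  fixes A :: "real^'m^'m::finite"
  assumes A: "positive_definite A"
    and f: "\<And>i v. \<bar>f i v\<bar> \<le> C * norm (v :: real^'m) powr q"
    and eq: "\<And>i x. x \<in> S \<Longrightarrow> (\<Sum>j\<in>UNIV. A $ i $ j * laplacian (\<lambda>y. V y $ j) x) = f i (V x)"
  obtains B where "B \<ge> 0" "\<And>x. x \<in> S \<Longrightarrow> norm (vector_laplacian V x) \<le> B * norm (V x) powr q"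
proof -
  obtain A' where A': "A' ** A = mat 1" using invertible_if_positive_definite[OF A] .
  define B where "B = onorm ((*v) A') * (real CARD('m) * \<bar>C\<bar>)"
  have bl: "bounded_linear ((*v) A')" by (rule matrix_vector_mul_bounded_linear)
  have "norm (vector_laplacian V x) \<le> B * norm (V x) powr q"
    if "x \<in> S" for x
  proof -
    have "A *v vector_laplacian V x = (\<chi> i. f i (V x))"
      by (simp add: matrix_vector_mult_def vector_laplacian_def eq[OF that])
    then have "vector_laplacian V x = A' *v (\<chi> i. f i (V x))"
      using A' by (metis matrix_vector_mul_assoc matrix_vector_mul_lid)
    then have "norm (vector_laplacian V x) \<le> onorm ((*v) A') * norm (\<chi> i. f i (V x))"
      using onorm[OF bl] by simp
    also have "\<dots> \<le> onorm ((*v) A') * (real CARD('m) * \<bar>C\<bar> * norm (V x) powr q)"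
    proof (rule mult_left_mono[OF _ onorm_pos_le[OF bl]])
      have "norm (\<chi> i. f i (V x)) \<le> (\<Sum>i\<in>UNIV. \<bar>f i (V x)\<bar>)"
        using norm_le_l1_cart[of "\<chi> i. f i (V x)"] by simp
      also have "\<dots> \<le> (\<Sum>i\<in>(UNIV::'m set). \<bar>C\<bar> * norm (V x) powr q)"
        by (intro sum_mono order_trans[OF f] mult_right_mono) auto
      finally show "norm (\<chi> i. f i (V x)) \<le> real CARD('m) * \<bar>C\<bar> * norm (V x) powr q" by simp
    qed
    finally show ?thesis by (simp add: B_def mult.assoc)
  qed
  moreover have "B \<ge> 0" unfolding B_def using onorm_pos_le[OF bl] by simp
  ultimately show thesis using that by blast
qed

lemma grad_norm_le:
  fixes V :: "real^'n::finite \<Rightarrow> real^'m::finite"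
  assumes "\<And>i j. \<bar>partial_deriv i (\<lambda>y. V y $ j) x\<bar> \<le> b"
  shows "grad_norm V x \<le> sqrt (real CARD('n) * real CARD('m)) * b"
proof -
  have "0 \<le> b" using assms order_trans[OF abs_ge_zero] by blast
  have "(\<Sum>i\<in>UNIV. \<Sum>j\<in>UNIV. \<bar>partial_deriv i (\<lambda>y. V y $ j) x\<bar>\<^sup>2)
    \<le> (\<Sum>i\<in>(UNIV::'n set). \<Sum>j\<in>(UNIV::'m set). b\<^sup>2)"
    by (intro sum_mono power_mono assms) auto
  then have "grad_norm V x \<le> sqrt (real CARD('n) * real CARD('m) * b\<^sup>2)"
    unfolding grad_norm_def by (intro real_sqrt_le_mono) (simp add: mult.assoc)
  then show ?thesis using \<open>0 \<le> b\<close> by (simp add: real_sqrt_mult)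
qed

lemma bigo_norm_powr_at_infinity:
  fixes g :: "'a::real_normed_vector \<Rightarrow> real"
  assumes "\<And>x. R \<le> norm x \<Longrightarrow> \<bar>g x\<bar> \<le> c * norm x powr a"
  shows "g \<in> O[at_infinity](\<lambda>x. norm x powr a)"
proof (rule bigoI)
  show "\<forall>\<^sub>F x in at_infinity. norm (g x) \<le> c * norm (norm x powr a)"
    unfolding eventually_at_infinity using assms by (intro exI[of _ R]) simp
qed

theorem theorem1:
  fixes q p C :: real
    and A :: "real^'m^'m::finite"
    and f :: "'m \<Rightarrow> real^'m \<Rightarrow> real"
    and K :: "(real^'n::finite) set"
    and V :: "real^'n \<Rightarrow> real^'m"
  assumes dim: "CARD('n) \<ge> 3"
    and q: "q > (real CARD('n) + 2) / real CARD('n)"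
    and p: "p = real CARD('n) / 2 * (q - 1)"
    and A_sym: "transpose A = A"
    and A_pos: "positive_definite A"
    and f_C1: "\<And>i. C1_on UNIV (f i)"
    and f_bound: "\<And>i v. \<bar>f i v\<bar> \<le> C * norm v powr q"
    and grad_f_bound: "\<And>i v. norm (grad (f i) v) \<le> C * norm v powr (q - 1)"
    and K: "compact K"
    and V_C2: "\<And>j. C2_on (- K) (\<lambda>x. V x $ j)"
    and V_eq: "\<And>i x. x \<in> - K \<Longrightarrow>
       (\<Sum>j\<in>UNIV. A $ i $ j * laplacian (\<lambda>y. V y $ j) x) = f i (V x)"
    and V_Lp: "in_Lp p (- K) V"
  shows "(\<lambda>x. norm (V x)) \<in> O[at_infinity](\<lambda>x. norm x powr (- (real CARD('n) - 2)))
    \<and> grad_norm V \<in> O[at_infinity](\<lambda>x. norm x powr (- (real CARD('n) - 1)))"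
proof -
  obtain B where "B \<ge> 0" and B: "\<And>x. x \<in> - K \<Longrightarrow> norm (vector_laplacian V x) \<le> B * norm (V x) powr q"
    using norm_vector_laplacian_le[OF A_pos f_bound V_eq] by blast
  have "1 < (real CARD('n) + 2) / real CARD('n)" by simp
  then have "q > 1" using q by linarith
  interpret critical_exterior_solution V K q B
  proof
    show "integrable (lebesgue_on (- K)) (\<lambda>x. norm (V x) powr (real CARD('n) / 2 * (q - 1)))"
      using V_Lp by (simp add: in_Lp_def p)
    show "norm (vector_laplacian V x) \<le> B * norm (V x) powr q" if "x \<notin> K" for x
      using B that by simp
  qed fact+
  obtain R c where "R > 0" "c \<ge> 0" and V_le: "\<And>x. R \<le> norm x \<Longrightarrow> norm (V x) \<le> c * norm x powr - (real CARD('n) - 2)"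
    by (rule V_optimal_decay) (rule that; simp)
  obtain R' c' where "R' > 0" "c' \<ge> 0" and grad: "\<And>x i j. R' \<le> norm x \<Longrightarrow>
      \<bar>partial_deriv i (\<lambda>y. V y $ j) x\<bar> \<le> c' * norm x powr - (real CARD('n) - 1)"
    by (rule gradient_optimal_decay) (rule that; simp)
  show ?thesis
  proof (intro conjI bigo_norm_powr_at_infinity)
    show "\<bar>norm (V x)\<bar> \<le> c * norm x powr - (real CARD('n) - 2)" if "R \<le> norm x" for x
      using V_le[OF that] by simp
    show "\<bar>grad_norm V x\<bar> \<le> sqrt (real CARD('n) * real CARD('m)) * c' * norm x powr - (real CARD('n) - 1)"
      if "R' \<le> norm x" for x
    proof -
      have "0 \<le> grad_norm V x" by (simp add: grad_norm_def sum_nonneg)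
      then show ?thesis using grad_norm_le[OF grad[OF that]] by (simp add: mult.assoc)
    qed
  qed
qed

end
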